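(* Let $s,\ell$ be positive integers with $s\le\ell$, let $\tau=\deg_{\mathcal{H}}\Lambda_s$, and suppose $\tau+\ell m_{\mathrm H}<sn$ and $$\tau>\tau_{\max}:=sn\Big(1-\frac{sC_{<s}-W_{<s}}{sC_{\le\ell}}\Big)-\frac{h}{h+1}\ell m_{\mathrm H}+\Big(\frac{1}{C_{\le\ell}}-1\Big)+g.$$ Then Problem 1 (with parameters $s,\ell$) has at least two solutions of degree $\tau$.
   Context: Let $q$ be a prime power; the Hermitian curve over $\mathbb{F}_{q^2}$ has affine equation $Y^q+Y=X^{q+1}$, genus $g=\tfrac12q(q-1)$, affine rational points $P_1,\dots,P_n$ ($n=q^3$) and point at infinity $P_\infty$. $\mathcal{R}=\bigcup_{m\ge0}\mathcal{L}(mP_\infty)=\mathbb{F}_{q^2}[X,Y]/(Y^q+Y-X^{q+1})$ with basis $\{X^iY^j:i\ge0,0\le j<q\}$; $\deg_{\mathcal{H}}f=-v_{P_\infty}(f)$, so $\deg_{\mathcal{H}}(X^iY^j)=iq+j(q+1)$; $f\ne0$ is monic if the coefficient of its basis monomial of largest $\deg_{\mathcal{H}}$ is $1$. Fix integers $h\ge1$, $m_{\mathrm H}$ with $2(g-1)<m_{\mathrm H}<n$. Let $\mathbf{f}\in\mathcal{L}(m_{\mathrm H}P_\infty)^h$, $\mathbf{r}=\mathbf{c}+\mathbf{e}\in\mathbb{F}_{q^2}^{h\times n}$ with $\mathbf{c}$ having $i$-th row $(f_i(P_1),\dots,f_i(P_n))$, $\mathcal{E}$ the set of indices of nonzero columns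 of $\mathbf{e}$; $\Lambda_s$ the unique monic element of minimal $\deg_{\mathcal{H}}$ of $\{\Lambda\in\mathcal{R}:v_{P_i}(\Lambda)\ge s\ \forall i\in\mathcal{E}\}$. $\mathbf{R}=(R_1,\dots,R_h)$, $R_i\in\mathcal{R}$, $\deg_{\mathcal{H}}R_i<n+2g$, $R_i(P_j)=r_{i,j}$; $G=X^{q^2}-X$. For $\mathbf{i},\mathbf{j}\in\mathbb{Z}_{\ge0}^h$: $|\mathbf{i}|=\sum_\mu i_\mu$, $\mathbf{i}\preceq\mathbf{j}$ componentwise, $\mathbf{a}^{\mathbf{i}}=\prod_\mu a_\mu^{i_\mu}$, $\binom{\mathbf{j}}{\mathbf{i}}=\prod_\mu\binom{j_\mu}{i_\mu}$. Problem 1: $\mathcal{I}=\{\mathbf{i}:|\mathbf{i}|<s\}$, $\mathcal{J}=\{\mathbf{j}:1\le|\mathbf{j}|\le\ell\}$, $A_{\mathbf{i},\mathbf{j}}=\binom{\mathbf{j}}{\mathbf{i}}\mathbf{R}^{\mathbf{j}-\mathbf{i}}G^{|\mathbf{i}|}$ ($=0$ if $\mathbf{i}\not\preceq\mathbf{j}$). A solution is a family $\lambda_{\mathbf{i}},\psi_{\mathbf{j}}\in\mathcal{R}$ with $\lambda_{\mathbf{0}}$ monic, $\psi_{\mathbf{j}}=\sum_{\mathbf{i}\in\mathcal{I}}\lambda_{\mathbf{i}}A_{\mathbf{i},\mathbf{j}}$ for $|\mathbf{j}|<s$, $\psi_{\mathbf{j}}\equiv\sum_{\mathbf{i}\in\mathcal{I}}\lambda_{\mathbf{i}}A_{\mathbf{i},\mathbf{j}}\bmod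 G^s$ for $|\mathbf{j}|\ge s$, $\deg_{\mathcal{H}}\lambda_{\mathbf{0}}\ge\deg_{\mathcal{H}}\lambda_{\mathbf{i}}-|\mathbf{i}|(2g-1)$ for $\mathbf{i}\in\mathcal{I}$, and $\deg_{\mathcal{H}}\lambda_{\mathbf{0}}\ge\deg_{\mathcal{H}}\psi_{\mathbf{j}}-|\mathbf{j}|m_{\mathrm H}$ for $\mathbf{j}\in\mathcal{J}$; its degree is $\deg_{\mathcal{H}}\lambda_{\mathbf{0}}$. Counting quantities (over $\mathbb{Z}_{\ge0}^h$): $C_{\le\ell}=\#\{\mathbf{j}:|\mathbf{j}|\le\ell\}$, $C_{<s}=\#\{\mathbf{i}:|\mathbf{i}|<s\}$, $W_{<s}=\sum_{|\mathbf{i}|<s}|\mathbf{i}|$. *)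

theory Defs
  imports Complex_Main "HOL-Computational_Algebra.Polynomial"
begin

text \<open>Coordinate ring R = F[X,Y]/(Y^q+Y-X^(q+1)) of the Hermitian curve.
  Elements of F[X,Y] are represented as polynomials in Y with coefficients in F[X]
  (type 'a poly poly); an element of R is represented by its reduced form,
  i.e. a polynomial of Y-degree < q (basis X^i Y^j, j < q).\<close>

definition hX :: "'a::comm_ring_1 poly poly" where "hX = [: [:0, 1:] :]"
definition hY :: "'a::comm_ring_1 poly poly" where "hY = [:0, 1:]"

definition hermH :: "nat \<Rightarrow> 'a::comm_ring_1 poly poly" where
  "hermH q = hY ^ q + hY - hX ^ (q + 1)"

definition hermG :: "nat \<Rightarrow> 'a::comm_ring_1 poly poly" where
  "hermG q = hX ^ (q ^ 2) - hX"

definition hermg :: "nat \<Rightarrow> nat" where "hermg q = q * (q - 1) div 2"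

definition inR :: "nat \<Rightarrow> 'a::comm_ring_1 poly poly \<Rightarrow> bool" where
  "inR q f = (degree f < q)"

definition eqR :: "nat \<Rightarrow> 'a::comm_ring_1 poly poly \<Rightarrow> 'a poly poly \<Rightarrow> bool" where
  "eqR q f g = (hermH q dvd (f - g))"

definition congR :: "nat \<Rightarrow> 'a::comm_ring_1 poly poly \<Rightarrow> 'a poly poly \<Rightarrow> 'a poly poly \<Rightarrow> bool" where
  "congR q f g m = (\<exists>t. eqR q f (g + t * m))"

definition evalH :: "'a::comm_ring_1 poly poly \<Rightarrow> 'a \<times> 'a \<Rightarrow> 'a" where
  "evalH f P = poly (poly f [:snd P:]) (fst P)"

definition hermPts :: "nat \<Rightarrow> ('a::comm_ring_1 \<times> 'a) set" where
  "hermPts q = {P. snd P ^ q + snd P = fst P ^ (q + 1)}"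

text \<open>deg_H(X^i Y^j) = iq + j(q+1); degH_le f d means deg_H f \<le> d (vacuous for f = 0)\<close>
definition degH_le :: "nat \<Rightarrow> 'a::comm_ring_1 poly poly \<Rightarrow> int \<Rightarrow> bool" where
  "degH_le q f d = (\<forall>i j. coeff (coeff f j) i \<noteq> 0 \<longrightarrow> int (i * q + j * (q + 1)) \<le> d)"

definition degH :: "nat \<Rightarrow> 'a::comm_ring_1 poly poly \<Rightarrow> nat" where
  "degH q f = Max {i * q + j * (q + 1) | i j. coeff (coeff f j) i \<noteq> 0}"

definition monicH :: "nat \<Rightarrow> 'a::comm_ring_1 poly poly \<Rightarrow> bool" where
  "monicH q f = (inR q f \<and> f \<noteq> 0 \<and>
     (\<exists>i j. coeff (coeff f j) i = 1 \<and> i * q + j * (q + 1) = degH q f))"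

text \<open>v_P(f) \<ge> s for an affine rational point P=(a,b), expressed as f \<in> m_P^s,
  where m_P = (X-a, Y-b) R is the maximal ideal of P in the Dedekind domain R
  (so that m_P^s = {f \<in> R. v_P(f) \<ge> s}).\<close>
definition val_ge :: "nat \<Rightarrow> 'a::comm_ring_1 poly poly \<Rightarrow> 'a \<times> 'a \<Rightarrow> nat \<Rightarrow> bool" where
  "val_ge q f P s = (\<exists>gs :: nat \<Rightarrow> 'a poly poly.
     eqR q f (\<Sum>k\<le>s. gs k * (hX - [: [:fst P:] :]) ^ k * (hY - [: [:snd P:] :]) ^ (s - k)))"

definition errset :: "nat \<Rightarrow> nat \<Rightarrow> (nat \<Rightarrow> 'a \<times> 'a \<Rightarrow> 'a::comm_ring_1) \<Rightarrow> ('a \<times> 'a) set" where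
  "errset q h e = {P \<in> hermPts q. \<exists>i<h. e i P \<noteq> 0}"

text \<open>tau = deg_H Lambda_s: the minimal deg_H of a nonzero element of R
  (equivalently of the monic Lambda_s) with v_P \<ge> s at all error positions\<close>
definition tauH :: "nat \<Rightarrow> nat \<Rightarrow> nat \<Rightarrow> (nat \<Rightarrow> 'a \<times> 'a \<Rightarrow> 'a::comm_ring_1) \<Rightarrow> nat" where
  "tauH q h s e = (LEAST d. \<exists>L :: 'a poly poly. inR q L \<and> L \<noteq> 0 \<and> degH q L = d \<and>
                      (\<forall>P \<in> errset q h e. val_ge q L P s))"

text \<open>multi-indices in Z_{\<ge>0}^h, as functions supported on {0..<h}\<close>
definition mi :: "nat \<Rightarrow> (nat \<Rightarrow> nat) set" where
  "mi h = {i. \<forall>\<mu>\<ge>h. i \<mu> = 0}"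

definition absm :: "nat \<Rightarrow> (nat \<Rightarrow> nat) \<Rightarrow> nat" where
  "absm h i = (\<Sum>\<mu><h. i \<mu>)"

definition Iset :: "nat \<Rightarrow> nat \<Rightarrow> (nat \<Rightarrow> nat) set" where
  "Iset h s = {i \<in> mi h. absm h i < s}"

definition Jset :: "nat \<Rightarrow> nat \<Rightarrow> (nat \<Rightarrow> nat) set" where
  "Jset h l = {j \<in> mi h. 1 \<le> absm h j \<and> absm h j \<le> l}"

definition Cle :: "nat \<Rightarrow> nat \<Rightarrow> nat" where
  "Cle h l = card {j \<in> mi h. absm h j \<le> l}"

definition Clt :: "nat \<Rightarrow> nat \<Rightarrow> nat" where
  "Clt h s = card (Iset h s)"

definition Wlt :: "nat \<Rightarrow> nat \<Rightarrow> nat" where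
  "Wlt h s = (\<Sum>i\<in>Iset h s. absm h i)"

definition Aent :: "nat \<Rightarrow> nat \<Rightarrow> (nat \<Rightarrow> 'a::comm_ring_1 poly poly) \<Rightarrow> (nat \<Rightarrow> nat) \<Rightarrow> (nat \<Rightarrow> nat) \<Rightarrow> 'a poly poly" where
  "Aent q h R i j =
     (if (\<forall>\<mu><h. i \<mu> \<le> j \<mu>)
      then of_nat (\<Prod>\<mu><h. j \<mu> choose i \<mu>) * (\<Prod>\<mu><h. R \<mu> ^ (j \<mu> - i \<mu>)) * hermG q ^ absm h i
      else 0)"

definition is_solution :: "nat \<Rightarrow> nat \<Rightarrow> nat \<Rightarrow> nat \<Rightarrow> nat \<Rightarrow> (nat \<Rightarrow> 'a::comm_ring_1 poly poly)
    \<Rightarrow> ((nat \<Rightarrow> nat) \<Rightarrow> 'a poly poly) \<Rightarrow> ((nat \<Rightarrow> nat) \<Rightarrow> 'a poly poly) \<Rightarrow> bool" where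
  "is_solution q h mH s l R lam psi =
    ((\<forall>i\<in>Iset h s. inR q (lam i)) \<and> (\<forall>j\<in>Jset h l. inR q (psi j)) \<and>
     monicH q (lam (\<lambda>_. 0)) \<and>
     (\<forall>j\<in>Jset h l. absm h j < s \<longrightarrow>
        eqR q (psi j) (\<Sum>i\<in>Iset h s. lam i * Aent q h R i j)) \<and>
     (\<forall>j\<in>Jset h l. s \<le> absm h j \<longrightarrow>
        congR q (psi j) (\<Sum>i\<in>Iset h s. lam i * Aent q h R i j) (hermG q ^ s)) \<and>
     (\<forall>i\<in>Iset h s. degH_le q (lam i)
        (int (degH q (lam (\<lambda>_. 0))) + int (absm h i) * (2 * int (hermg q) - 1))) \<and>
     (\<forall>j\<in>Jset h l. degH_le q (psi j)
        (int (degH q (lam (\<lambda>_. 0))) + int (absm h j) * int mH)))"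

definition tau_max :: "nat \<Rightarrow> nat \<Rightarrow> nat \<Rightarrow> nat \<Rightarrow> nat \<Rightarrow> real" where
  "tau_max q h mH s l =
     real s * real (q ^ 3) * (1 - (real s * real (Clt h s) - real (Wlt h s)) / (real s * real (Cle h l)))
     - real h / real (h + 1) * real l * real mH
     + (1 / real (Cle h l) - 1) + real (hermg q)"

end

theory Submission
  imports Defs "HOL-Computational_Algebra.Primes" "HOL-Library.FuncSet"
begin

text \<open>
  The transmitted codeword gives one solution \<open>\<lambda>\<^sub>i = \<Lambda>\<^sub>s (f - R)^i / G^|i|\<close>, \<open>\<psi>\<^sub>j = \<Lambda>\<^sub>s f^j\<close>: the functions
  \<open>f\<^sub>\<mu> - R\<^sub>\<mu>\<close> vanish at all error-free points and \<open>\<Lambda>\<^sub>s\<close> vanishes to order \<open>s\<close> at the others, so the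
  divisions are exact for \<open>|i| < s\<close>, and the terms with \<open>|i| \<ge> s\<close> in the binomial expansion
  of \<open>f^j = ((f - R) + R)^j\<close> are divisible by \<open>G^s\<close>.  For \<open>\<tau> > \<tau>_max\<close> the key equations, together
  with the condition that \<open>\<lambda>\<^sub>0\<close> has no term of degree \<open>\<tau>\<close>, form a homogeneous linear system with
  more unknowns than equations.  Adding a nonzero element of its kernel to the first solution
  gives the second one.
\<close>

section \<open>The weighted degree\<close>

text \<open>Orders of vanishing enter through local divisibility by powers of X - a. What makes it
  global is a fibre count: at least q points of the curve lie over each a, while a reduced element
  has Y-degree below q. Since G is a polynomial in X alone, dividing by G^k acts on each
  Y-coefficient and keeps the form reduced.

  The kernel element is found by counting: over a finite field, a map from the unknowns to the
  equations whose domain is larger than its codomain has two arguments with the same image, and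
  their difference solves the homogeneous system.

  The summands of \<open>tau_max\<close> have these origins. The defect g - 1 of Riemann's
  inequality is incurred \<open>Cle h l\<close> times, once for each \<open>lam i\<close> and once
  for each \<open>psi j\<close> with |j| \<ge> s; 1 / \<open>Cle h l\<close> is the one additional
  equation spread over these indices; h l / (h + 1) is the mean of |j| over |j| \<le> l. For 1 \<le>
  |j| < s the number of equations is compared directly with the number of unknowns in
  \<open>psi j\<close>, which costs no genus term beyond one that the \<open>lam i\<close>
  repay.\<close>

lemma finite_supp: "finite {(i, j). coeff (coeff f j) i \<noteq> 0}"
proof -
  have "{(i, j). coeff (coeff f j) i \<noteq> 0} \<subseteq> (\<lambda>(j, i). (i, j)) ` (SIGMA j:{..degree f}. {..degree (coeff f j)})"
  proof clarify
    fix i j assume ij: "coeff (coeff f j) i \<noteq> 0"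
    then have "coeff f j \<noteq> 0" by auto
    then have "j \<le> degree f" "i \<le> degree (coeff f j)" using ij by (auto intro: le_degree)
    then show "(i, j) \<in> (\<lambda>(j, i). (i, j)) ` (SIGMA j:{..degree f}. {..degree (coeff f j)})"
      by force
  qed
  then show ?thesis by (rule finite_subset) auto
qed

lemma ex_nonzero_coeff: "f \<noteq> 0 \<Longrightarrow> \<exists>i j. coeff (coeff f j) i \<noteq> 0"
  by (metis leading_coeff_0_iff)

lemma finite_weight_values: "finite {i * q + j * (q + 1) | i j. coeff (coeff f j) i \<noteq> 0}"
  using finite_imageI[OF finite_supp, of "\<lambda>(i, j). i * q + j * (q + 1)" f]
  by (rule back_subst[of finite]) auto

lemma degH_le_degH: "degH_le q f (int (degH q f))"
  unfolding degH_le_def degH_def of_nat_le_iff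
  by (intro allI impI Max_ge finite_weight_values) blast

lemma degH_attained:
  assumes "f \<noteq> 0"
  obtains i j where "coeff (coeff f j) i \<noteq> 0" "i * q + j * (q + 1) = degH q f"
proof -
  have "degH q f \<in> {i * q + j * (q + 1) | i j. coeff (coeff f j) i \<noteq> 0}"
    unfolding degH_def using ex_nonzero_coeff[OF assms] by (intro Max_in finite_weight_values) auto
  then show ?thesis using that by auto
qed

lemma degH_eqI:
  assumes "degH_le q f (int d)" "coeff (coeff f j) i \<noteq> 0" "i * q + j * (q + 1) = d"
  shows "degH q f = d"
  unfolding degH_def
proof (rule Max_eqI[OF finite_weight_values])
  show "y \<le> d" if "y \<in> {i * q + j * (q + 1) |i j. coeff (coeff f j) i \<noteq> 0}" for y
    using that assms(1) unfolding degH_le_def by (auto simp flip: of_nat_add of_nat_mult)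
qed (use assms in auto)

lemma degH_le_0 [simp]: "degH_le q 0 d"
  by (simp add: degH_le_def)

lemma degH_le_mono: "degH_le q f a \<Longrightarrow> a \<le> b \<Longrightarrow> degH_le q f b"
  unfolding degH_le_def by force

lemma degH_le_add: "degH_le q f d \<Longrightarrow> degH_le q g d \<Longrightarrow> degH_le q (f + g) d"
  unfolding degH_le_def by (metis add.right_neutral coeff_add)

lemma degH_le_uminus: "degH_le q f d \<Longrightarrow> degH_le q (- f) d"
  unfolding degH_le_def by simp

lemma degH_le_diff: "degH_le q f d \<Longrightarrow> degH_le q g d \<Longrightarrow> degH_le q (f - g) d"
  using degH_le_add[of q f d "- g"] degH_le_uminus by fastforce

lemma degH_le_sum: "(\<And>x. x \<in> A \<Longrightarrow> degH_le q (f x) d) \<Longrightarrow> degH_le q (sum f A) d"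
  by (induction A rule: infinite_finite_induct) (auto intro: degH_le_add)

lemma degH_le_mult:
  assumes "degH_le q f a" "degH_le q g b"
  shows "degH_le q (f * g) (a + b)"
  unfolding degH_le_def
proof (intro allI impI)
  fix i j assume "coeff (coeff (f * g) j) i \<noteq> 0"
  then have "(\<Sum>k\<le>j. \<Sum>m\<le>i. coeff (coeff f k) m * coeff (coeff g (j - k)) (i - m)) \<noteq> 0"
    by (simp add: coeff_mult coeff_sum)
  then obtain k m where km: "k \<le> j" "m \<le> i"
    "coeff (coeff f k) m * coeff (coeff g (j - k)) (i - m) \<noteq> 0"
    by (meson atMost_iff sum.not_neutral_contains_not_neutral)
  then have "coeff (coeff f k) m \<noteq> 0" "coeff (coeff g (j - k)) (i - m) \<noteq> 0" by auto
  then have *: "int (m * q + k * (q + 1)) \<le> a" "int ((i - m) * q + (j - k) * (q + 1)) \<le> b"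
    using assms unfolding degH_le_def by blast+
  obtain i' j' where "i = m + i'" "j = k + j'" using km by (metis le_iff_add)
  with * show "int (i * q + j * (q + 1)) \<le> a + b"
    by (simp add: algebra_simps)
qed

lemma degH_le_1: "degH_le q 1 0"
  by (auto simp: degH_le_def coeff_1 split: if_splits)

lemma degH_le_of_nat: "degH_le q (of_nat n) 0"
  by (induction n) (auto intro: degH_le_add degH_le_1)

lemma degH_le_power: "degH_le q f d \<Longrightarrow> degH_le q (f ^ n) (int n * d)"
  by (induction n) (auto simp: algebra_simps intro: degH_le_1 degH_le_mult)

lemma degH_le_prod:
  "finite A \<Longrightarrow> (\<And>x. x \<in> A \<Longrightarrow> degH_le q (f x) (d x)) \<Longrightarrow> degH_le q (prod f A) (sum d A)"
  by (induction A rule: finite_induct) (auto intro: degH_le_1 degH_le_mult)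

lemma coeff_mult_const: "coeff (w * [:c:]) j = coeff w j * (c :: 'a :: comm_ring_1)"
  by (metis coeff_smult mult.commute mult_pCons_right add.right_neutral mult_zero_right pCons_0_0)

text \<open>Over a domain the leading X-power of each Y-coefficient survives multiplication by
  \<open>c\<close>, so removing this factor lowers the weight bound by q per X-degree. The bound on
  \<open>lam i\<close> after division by a power of G comes from here.\<close>

lemma degH_le_cancel_const:
  fixes c :: "'a::idom poly"
  assumes "degH_le q (w * [:c:]) d" "c \<noteq> 0"
  shows "degH_le q w (d - int (q * degree c))"
  unfolding degH_le_def
proof (intro allI impI)
  fix i j assume ij: "coeff (coeff w j) i \<noteq> 0"
  then have nz: "coeff w j \<noteq> 0" by auto
  have "lead_coeff (coeff w j * c) \<noteq> 0" using nz assms(2) by simp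
  moreover have "degree (coeff w j * c) = degree (coeff w j) + degree c"
    using nz assms(2) by (simp add: degree_mult_eq)
  ultimately have "coeff (coeff (w * [:c:]) j) (degree (coeff w j) + degree c) \<noteq> 0"
    unfolding coeff_mult_const by simp
  then have "int ((degree (coeff w j) + degree c) * q + j * (q + 1)) \<le> d"
    using assms(1) unfolding degH_le_def by blast
  moreover have "int (i * q) \<le> int (degree (coeff w j) * q)"
    unfolding of_nat_le_iff using le_degree[OF ij] by (rule mult_le_mono1)
  ultimately show "int (i * q + j * (q + 1)) \<le> d - int (q * degree c)"
    by (simp add: algebra_simps)
qed

lemma degH_le_monom:
  "(\<And>i. coeff c i \<noteq> 0 \<Longrightarrow> int (i * q + n * (q + 1)) \<le> d) \<Longrightarrow> degH_le q (monom c n) d"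
  by (auto simp: degH_le_def)

section \<open>Reduction modulo the curve equation\<close>

lemma hX_eq: "hX = [:monom 1 1:]"
  by (simp add: hX_def monom_altdef)

lemma hX_power: "hX ^ n = [:monom 1 n:]"
  by (induction n) (simp_all add: hX_eq mult_monom pCons_one)

lemma hY_power: "hY ^ n = monom 1 n"
  by (simp add: hY_def monom_altdef)

lemma hermH_eq: "hermH q = monom 1 q + monom 1 1 - [:monom 1 (q + 1):]"
  unfolding hermH_def hX_power hY_power using hY_power[of 1] by simp

lemma degree_hermH:
  assumes "q \<ge> 2"
  shows "degree (hermH q :: 'a::comm_ring_1 poly poly) = q" "lead_coeff (hermH q :: 'a poly poly) = 1"
proof -
  have c: "coeff (hermH q :: 'a poly poly) n = (if n = q then 1 else 0)" if "n \<ge> q" for n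
    using assms that by (auto simp: hermH_eq coeff_pCons split: nat.splits)
  show d: "degree (hermH q :: 'a poly poly) = q"
  proof (rule antisym)
    show "degree (hermH q :: 'a poly poly) \<le> q" by (rule degree_le) (auto simp: c)
    show "q \<le> degree (hermH q :: 'a poly poly)" by (rule le_degree) (simp add: c)
  qed
  show "lead_coeff (hermH q :: 'a poly poly) = 1" unfolding d by (simp add: c)
qed

text \<open>Y^q and X^(q+1) have the same weight q(q+1), so replacing Y^q by X^(q+1) - Y never
  raises the weighted degree.\<close>

lemma degH_le_hermH:
  assumes "q \<ge> 1" shows "degH_le q (hermH q) (int (q * (q + 1)))"
proof -
  have "degH_le q (monom 1 q) (int (q * (q + 1)))" "degH_le q (monom 1 1) (int (q * (q + 1)))"
    using assms mult_mono[of 1 "int q" 1 "int q"]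
    by (auto intro!: degH_le_monom simp: algebra_simps split: if_splits)
  moreover have "degH_le q [:monom 1 (q + 1):] (int (q * (q + 1)))"
    unfolding monom_0[symmetric] by (rule degH_le_monom) (auto simp: algebra_simps split: if_splits)
  ultimately show ?thesis unfolding hermH_eq by (intro degH_le_diff degH_le_add)
qed

lemma eqR_refl [simp]: "eqR q f f"
  by (simp add: eqR_def)

lemma eqR_sym: "eqR q f g \<Longrightarrow> eqR q g f"
  unfolding eqR_def by (metis dvd_minus_iff minus_diff_eq)

lemma eqR_trans [trans]: "eqR q f g \<Longrightarrow> eqR q g h \<Longrightarrow> eqR q f h"
  unfolding eqR_def using dvd_add[of "hermH q" "f - g" "g - h"] by simp

lemma eqR_add: "eqR q f g \<Longrightarrow> eqR q f' g' \<Longrightarrow> eqR q (f + f') (g + g')"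
  unfolding eqR_def using dvd_add[of "hermH q" "f - g" "f' - g'"] by (simp add: algebra_simps)

lemma eqR_diff: "eqR q f g \<Longrightarrow> eqR q f' g' \<Longrightarrow> eqR q (f - f') (g - g')"
  unfolding eqR_def using dvd_diff[of "hermH q" "f - g" "f' - g'"] by (simp add: algebra_simps)

lemma eqR_mult:
  assumes "eqR q f g" "eqR q f' g'"
  shows "eqR q (f * f') (g * g')"
proof -
  have "f * f' - g * g' = (f - g) * f' + g * (f' - g')" by (simp add: algebra_simps)
  then show ?thesis using assms unfolding eqR_def by (simp add: dvd_add)
qed

lemma eqR_sum: "(\<And>x. x \<in> A \<Longrightarrow> eqR q (f x) (g x)) \<Longrightarrow> eqR q (sum f A) (sum g A)"
  by (induction A rule: infinite_finite_induct) (auto intro: eqR_add)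

lemma inR_diff: "inR q f \<Longrightarrow> inR q g \<Longrightarrow> inR q (f - g)"
  unfolding inR_def by (rule degree_diff_less)

lemma inR_add: "inR q f \<Longrightarrow> inR q g \<Longrightarrow> inR q (f + g)"
  unfolding inR_def by (rule degree_add_less)

lemma inR_smult: "inR q f \<Longrightarrow> inR q (smult c f)"
  unfolding inR_def using degree_smult_le le_less_trans by blast

lemma inR_mult_const: "inR q f \<Longrightarrow> inR q (f * [:c:])"
  using inR_smult[of q f c] by simp

lemma reduced_unique:
  fixes f g :: "'a::idom poly poly"
  assumes "q \<ge> 2" "inR q f" "inR q g" "eqR q f g"
  shows "f = g"
proof (rule ccontr)
  assume "f \<noteq> g"
  then have "degree (hermH q :: 'a poly poly) \<le> degree (f - g)"
    using assms(4) unfolding eqR_def by (intro dvd_imp_degree_le) auto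
  then show False
    using degree_hermH(1)[OF assms(1), where 'a='a] inR_diff[OF assms(2,3)] by (simp add: inR_def)
qed

text \<open>Long division by \<open>hermH q\<close>, which is monic in Y: the multiple subtracted to
  cancel the leading Y-term again has weight at most \<open>d\<close>.\<close>

lemma ex_reduced:
  fixes f :: "'a::idom poly poly"
  assumes q: "q \<ge> 2"
  shows "degH_le q f d \<Longrightarrow> \<exists>r. inR q r \<and> degH_le q r d \<and> eqR q f r"
proof (induction "degree f" arbitrary: f rule: less_induct)
  case less
  show ?case
  proof (cases "degree f < q")
    case True
    then show ?thesis using less.prems by (auto simp: inR_def)
  next
    case False
    define N where "N = degree f"
    define t where "t = monom (lead_coeff f) (N - q)"
    have N: "N \<ge> q" using False N_def by simp
    have lt: "degree (f - t * hermH q) < degree f"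
    proof (rule le_neq_implies_less)
      have "degree (t * hermH q) \<le> (N - q) + q"
        using degree_mult_le[of t "hermH q"] degree_monom_le[of "lead_coeff f" "N - q"]
        unfolding degree_hermH[OF q] t_def[symmetric] by linarith
      then show "degree (f - t * hermH q) \<le> degree f"
        using N by (intro degree_diff_le) (auto simp: N_def)
      have "coeff (t * hermH q) N = lead_coeff f"
        unfolding t_def coeff_monom_mult using N degree_hermH[OF q, where 'a='a] by simp
      then have "coeff (f - t * hermH q) (degree f) = 0" by (simp add: N_def)
      then show "degree (f - t * hermH q) \<noteq> degree f"
        using N q unfolding N_def by (metis degree_0 leading_coeff_0_iff not_less_eq_eq numeral_2_eq_2 le_zero_eq zero_le order_trans)
    qed
    have "degH_le q t (d - int (q * (q + 1)))"
      unfolding t_def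
    proof (rule degH_le_monom)
      fix i assume "coeff (lead_coeff f) i \<noteq> 0"
      then have "int (i * q + N * (q + 1)) \<le> d"
        using less.prems unfolding degH_le_def N_def by blast
      moreover have "N = (N - q) + q" using N by simp
      ultimately have "int (i * q + ((N - q) + q) * (q + 1)) \<le> d" by metis
      then show "int (i * q + (N - q) * (q + 1)) \<le> d - int (q * (q + 1))"
        by (simp add: algebra_simps)
    qed
    from degH_le_mult[OF this degH_le_hermH] q have "degH_le q (f - t * hermH q) d"
      using less.prems by (intro degH_le_diff) auto
    from less.hyps[OF lt this] obtain r where "inR q r" "degH_le q r d" "eqR q (f - t * hermH q) r"
      by blast
    moreover have "eqR q f (f - t * hermH q)" by (simp add: eqR_def)
    ultimately show ?thesis using eqR_trans by blast
  qed
qed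

definition red :: "nat \<Rightarrow> 'a::idom poly poly \<Rightarrow> 'a poly poly" where
  "red q f = (SOME r. inR q r \<and> eqR q f r)"

context
  fixes q :: nat
  assumes q: "q \<ge> 2"
begin

lemma inR_red [simp]: "inR q (red q f)" and eqR_red: "eqR q f (red q f)"
  using someI_ex[of "\<lambda>r. inR q r \<and> eqR q f r"] ex_reduced[OF q degH_le_degH, of f]
  unfolding red_def by blast+

lemma red_eqI: "inR q r \<Longrightarrow> eqR q f r \<Longrightarrow> red q f = r"
  using q eqR_red eqR_sym eqR_trans inR_red reduced_unique by metis

lemma red_diff: "red q (f - g) = red q f - red q g"
  by (intro red_eqI inR_diff eqR_diff eqR_red inR_red)

text \<open>The choice behind \<open>red\<close> ignores the weight; uniqueness identifies its value
  with the remainder of bounded weight from \<open>ex_reduced\<close>.\<close>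

lemma degH_le_red:
  assumes "degH_le q f d" shows "degH_le q (red q f) d"
  using ex_reduced[OF q assms] red_eqI by blast

text \<open>R is free over F[X], so a nonzero polynomial in X is no zero divisor: multiplying by it
  preserves reduced forms, and between these congruence is plain equality.\<close>

lemma eqR_cancel_const:
  fixes w z :: "'a::idom poly poly"
  assumes "eqR q (w * [:c:]) (z * [:c:])" "c \<noteq> 0"
  shows "eqR q w z"
proof -
  have "eqR q (red q w * [:c:]) (red q z * [:c:])"
    by (meson assms(1) eqR_mult eqR_red eqR_refl eqR_sym eqR_trans)
  then have "red q w * [:c:] = red q z * [:c:]"
    by (intro reduced_unique[OF q] inR_mult_const inR_red)
  then have "red q w = red q z" using assms(2) by (simp del: mult_pCons_right)
  then show ?thesis using eqR_red eqR_sym eqR_trans by metis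
qed

end

section \<open>Rational points of the Hermitian curve\<close>

lemma power_card_eq_same:
  fixes x :: "'a::{field,finite}"
  shows "x ^ card (UNIV :: 'a set) = x"
proof (cases "x = 0")
  case False
  \<comment> \<open>Multiplication by x permutes the nonzero elements, so comparing the two products
    shows that x to the power of their number is 1.\<close>
  have "(\<Prod>y\<in>UNIV - {0}. x * y) = (\<Prod>y\<in>UNIV - {0}. y)"
    by (rule prod.reindex_bij_witness[of _ "\<lambda>y. y / x" "\<lambda>y. x * y"]) (use False in auto)
  then have "x ^ card (UNIV - {0 :: 'a}) * \<Prod>(UNIV - {0}) = \<Prod>(UNIV - {0})"
    by (simp add: prod.distrib)
  then have "x ^ card (UNIV - {0 :: 'a}) = 1" by simp
  then have "x ^ Suc (card (UNIV - {0 :: 'a})) = x" by simp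
  then show ?thesis by (subst (asm) card_Suc_Diff1) auto
qed (simp add: card_gt_0_iff)

lemma of_nat_card_eq_0: "of_nat (card (UNIV :: 'a set)) = (0 :: 'a::{field,finite})"
proof -
  \<comment> \<open>Translation by 1 permutes the field, so the added ones sum to 0.\<close>
  have "(\<Sum>x\<in>UNIV. x + (1 :: 'a)) = (\<Sum>x\<in>UNIV. x)"
    by (rule sum.reindex_bij_witness[of _ "\<lambda>x. x - 1" "\<lambda>x. x + 1"]) auto
  then show ?thesis by (simp add: sum.distrib)
qed

lemma CHAR_of_card:
  assumes "prime p" "card (UNIV :: 'a::{field,finite} set) = p ^ n"
  shows "CHAR('a) = p"
proof -
  have "of_nat p ^ n = (0 :: 'a)"
    using of_nat_card_eq_0[where 'a = 'a] assms(2) by simp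
  then have "of_nat p = (0 :: 'a)" by simp
  then have "CHAR('a) dvd p" by (simp add: of_nat_eq_0_iff_char_dvd)
  then show ?thesis using assms(1) CHAR_not_1[where 'a = 'a] by (metis prime_nat_iff One_nat_def)
qed

locale hermitian_curve =
  fixes q :: nat and field_type :: "'a::{field,finite} itself"
  assumes prime_power: "\<exists>p k. prime p \<and> 0 < k \<and> q = p ^ k"
    and card_field: "card (UNIV :: 'a set) = q ^ 2"
begin

lemma q_ge_2: "q \<ge> 2"
  using prime_power by (metis One_nat_def Suc_leI one_less_power prime_gt_1_nat numeral_2_eq_2)

text \<open>The type \<open>'b\<close> is general because the identity is applied both to field
  elements and to bivariate polynomials over the field.\<close>

lemma freshman_add:
  fixes x y :: "'b::comm_semiring_1"
  assumes "CHAR('b) = CHAR('a)"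
  shows "(x + y) ^ q = x ^ q + y ^ q"
proof -
  obtain p k where pk: "prime p" "q = p ^ k" using prime_power by blast
  then have "CHAR('a) = p"
    using CHAR_of_card[of p "k * 2"] card_field by (simp add: power_mult)
  then show ?thesis using freshmans_dream'[of q k x y] pk assms by simp
qed

lemma freshman_diff:
  fixes x y :: "'b::comm_ring_1"
  assumes "CHAR('b) = CHAR('a)"
  shows "(x - y) ^ q = x ^ q - y ^ q"
  using freshman_add[OF assms, of "x - y" y] by (simp add: algebra_simps)

lemma power_q2: "x ^ (q ^ 2) = (x :: 'a)"
  using power_card_eq_same[of x] card_field by simp

text \<open>Writing \<open>T = Y^q + Y - c\<close> with \<open>c = a^(q+1)\<close>, the equation \<open>c^q = c\<close> yields
  \<open>T^q - T = Y^(q^2) - Y\<close>, so that every element of the field is a root of \<open>T (T^(q-1) - 1)\<close>.\<close>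

lemma card_fibre: "card {b :: 'a. (a, b) \<in> hermPts q} \<ge> q"
proof -
  define c where "c = a ^ (q + 1)"
  define T :: "'a poly" where "T = monom 1 q + monom 1 1 - [:c:]"
  have q: "q \<ge> 2" by (rule q_ge_2)
  have degT: "degree T \<le> q" unfolding T_def
    using q by (intro degree_diff_le degree_add_le order.trans[OF degree_monom_le]) auto
  have T: "poly T y = y ^ q + y - c" for y by (simp add: T_def poly_monom)
  have cq: "c ^ q = c"
  proof -
    have "c ^ q = a ^ (q ^ 2) * a ^ q" unfolding c_def
      by (simp add: power2_eq_square algebra_simps flip: power_mult power_add)
    then show ?thesis by (simp add: power_q2 c_def)
  qed
  have TT: "poly T y ^ q = poly T y" for y
    using power_q2[of y] by (simp add: T freshman_diff freshman_add cq power2_eq_square power_mult)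
  have "poly T y = 0 \<or> poly (T ^ (q - 1) - 1) y = 0" for y
  proof -
    have "poly T y * (poly T y ^ (q - 1) - 1) = poly T y ^ Suc (q - 1) - poly T y"
      by (simp add: algebra_simps)
    also have "\<dots> = 0" using TT[of y] q by simp
    finally show ?thesis by simp
  qed
  \<comment> \<open>The second factor has at most q(q - 1) roots, which leaves at least q^2 - q(q -
    1) = q field elements as roots of \<open>T\<close>.\<close>
  then have un: "UNIV = {y. poly T y = 0} \<union> {y. poly (T ^ (q - 1) - 1) y = 0}" by blast
  have "T ^ (q - 1) - 1 \<noteq> 0"
  proof
    assume "T ^ (q - 1) - 1 = 0"
    then have "degree (T ^ (q - 1)) = degree (1 :: 'a poly)" by simp
    moreover have "coeff T q = 1" using q by (simp add: T_def coeff_pCons split: nat.splits)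
    then have degT': "degree T \<ge> q" by (intro le_degree) simp
    moreover have "T \<noteq> 0" using degT' q by auto
    ultimately show False using q by (auto simp: degree_power_eq)
  qed
  then have "card {y. poly (T ^ (q - 1) - 1) y = 0} \<le> degree (T ^ (q - 1) - 1)"
    by (rule card_poly_roots_bound)
  also have "\<dots> \<le> q * (q - 1)"
    using degT by (intro degree_diff_le order.trans[OF degree_power_le] mult_le_mono) auto
  finally have "q ^ 2 \<le> card {y. poly T y = 0} + q * (q - 1)"
    using un card_Un_le[of "{y. poly T y = 0}" "{y. poly (T ^ (q - 1) - 1) y = 0}"]
    by (simp flip: card_field)
  moreover have "{y. poly T y = 0} = {b. (a, b) \<in> hermPts q}"
    by (auto simp: T hermPts_def c_def)
  moreover have "q ^ 2 = q * (q - 1) + q"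
    using q by (cases q) (auto simp: power2_eq_square)
  ultimately show ?thesis by simp
qed

section \<open>Functions with prescribed multiplicities\<close>

lemma evalH_simps [simp]:
  "evalH (f + g) P = evalH f P + evalH g P"
  "evalH (f - g) P = evalH f P - evalH g P"
  "evalH (f * g) P = evalH f P * evalH g P"
  "evalH (f ^ n) P = evalH f P ^ n"
  "evalH hX P = fst P" "evalH hY P = snd P" "evalH [:c:] P = poly c (fst P)"
  "evalH 0 P = 0" "evalH 1 P = 1"
  by (simp_all add: evalH_def hX_def hY_def)

lemma evalH_hermH: "P \<in> hermPts q \<Longrightarrow> evalH (hermH q) P = 0"
  by (simp add: hermH_def hermPts_def)

lemma evalH_cong:
  assumes "eqR q f g" "P \<in> hermPts q" shows "evalH f P = evalH g P"
proof -
  obtain t where "f - g = hermH q * t" using assms(1) unfolding eqR_def by (elim dvdE)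
  then have "evalH (f - g) P = 0" using evalH_hermH[OF assms(2)] by simp
  then show ?thesis by simp
qed

text \<open>\<open>f \<in> (X - a)^k R\<^sub>P\<close>, where \<open>R\<^sub>P\<close> is the local ring at \<open>P = (a, b)\<close>.
  Since \<open>X - a\<close> is a uniformizer at \<open>P\<close>, this says that \<open>f\<close> vanishes to order \<open>k\<close>.\<close>

definition vanishes :: "nat \<Rightarrow> 'a poly poly \<Rightarrow> 'a \<times> 'a \<Rightarrow> bool" where
  "vanishes k f P \<longleftrightarrow> (\<exists>U t. evalH U P \<noteq> 0 \<and> eqR q (f * U) ([:[:- fst P, 1:]:] ^ k * t))"

lemma vanishes_0: "vanishes 0 f P"
  unfolding vanishes_def by (rule exI[of _ 1], rule exI[of _ f]) simp

lemma vanishes_mono: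
  assumes "vanishes k f P" "m \<le> k" shows "vanishes m f P"
proof -
  obtain U t where "evalH U P \<noteq> 0" "eqR q (f * U) ([:[:- fst P, 1:]:] ^ (m + (k - m)) * t)"
    using assms unfolding vanishes_def by auto
  then show ?thesis unfolding vanishes_def power_add mult.assoc by blast
qed

lemma vanishes_mult:
  assumes "vanishes k f P" "vanishes m g P" shows "vanishes (k + m) (f * g) P"
proof -
  obtain U t V u where "evalH U P \<noteq> 0" "evalH V P \<noteq> 0"
    "eqR q (f * U) ([:[:- fst P, 1:]:] ^ k * t)" "eqR q (g * V) ([:[:- fst P, 1:]:] ^ m * u)"
    using assms unfolding vanishes_def by blast
  moreover from eqR_mult[OF this(3,4)]
  have "eqR q ((f * g) * (U * V)) ([:[:- fst P, 1:]:] ^ (k + m) * (t * u))"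
    by (simp only: power_add mult_ac)
  ultimately show ?thesis unfolding vanishes_def
    by (intro exI[of _ "U * V"] exI[of _ "t * u"]) simp
qed

lemma vanishes_add:
  assumes "vanishes k f P" "vanishes k g P" shows "vanishes k (f + g) P"
proof -
  obtain U t V u where "evalH U P \<noteq> 0" "evalH V P \<noteq> 0"
    and *: "eqR q (f * U) ([:[:- fst P, 1:]:] ^ k * t)" "eqR q (g * V) ([:[:- fst P, 1:]:] ^ k * u)"
    using assms unfolding vanishes_def by blast
  moreover have "eqR q (f * U * V + g * V * U) ([:[:- fst P, 1:]:] ^ k * t * V + [:[:- fst P, 1:]:] ^ k * u * U)"
    by (rule eqR_add; rule eqR_mult; fact * eqR_refl)
  then have "eqR q ((f + g) * (U * V)) ([:[:- fst P, 1:]:] ^ k * (t * V + u * U))"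
    by (simp only: algebra_simps)
  ultimately show ?thesis unfolding vanishes_def
    by (intro exI[of _ "U * V"] exI[of _ "t * V + u * U"]) simp
qed

lemma vanishes_zero: "vanishes k 0 P"
  unfolding vanishes_def by (rule exI[of _ 1], rule exI[of _ 0]) simp

lemma vanishes_sum: "(\<And>x. x \<in> A \<Longrightarrow> vanishes k (f x) P) \<Longrightarrow> vanishes k (sum f A) P"
  by (induction A rule: infinite_finite_induct) (auto intro: vanishes_zero vanishes_add)

lemma vanishes_one_power: "vanishes 1 f P \<Longrightarrow> vanishes k (f ^ k) P"
  by (induction k) (auto simp: vanishes_0 dest: vanishes_mult)

lemma vanishes_cong:
  assumes "vanishes k g P" "eqR q f g" shows "vanishes k f P"
  using assms unfolding vanishes_def by (meson eqR_mult eqR_refl eqR_trans)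

lemma vanishes_mult_left: "vanishes k f P \<Longrightarrow> vanishes k (g * f) P"
  using vanishes_mult[OF vanishes_0] by fastforce

lemma vanishes_X: "vanishes 1 (hX - [:[:fst P:]:]) P"
proof -
  have "hX - [:[:fst P:]:] = [:[:- fst P, 1:]:]" by (simp add: hX_def)
  then show ?thesis unfolding vanishes_def
    by (intro exI[of _ 1]) simp
qed

text \<open>On the curve, \<open>(Y - b) ((Y - b)^(q-1) + 1) = (Y^q + Y) - (b^q + b) = X^(q+1) - a^(q+1)\<close>.\<close>

lemma vanishes_Y:
  assumes "P \<in> hermPts q" shows "vanishes 1 (hY - [:[:snd P:]:]) P"
proof -
  obtain a b where P: "P = (a, b)" by fastforce
  have ab: "b ^ q + b = a ^ (q + 1)" using assms by (simp add: P hermPts_def)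
  define Z where "Z = hY - [:[:b:]:]"
  \<comment> \<open>This cofactor is a unit at P: \<open>Z\<close> vanishes there and q - 1 > 0, so
    its value is 1.\<close>
  define U where "U = Z ^ (q - 1) + 1"
  have "[:- a, 1:] dvd monom 1 (q + 1) - [:a ^ (q + 1):]"
    by (simp add: poly_eq_0_iff_dvd[symmetric] poly_monom)
  then obtain t where t: "monom 1 (q + 1) - [:a ^ (q + 1):] = [:- a, 1:] * t" by (elim dvdE)
  have cpow: "[:[:b:]:] ^ q = [:[:b ^ q:]:]" by (induction q) (auto simp: pCons_one)
  have "Z * U = Z ^ Suc (q - 1) + Z" by (simp add: U_def algebra_simps)
  also have "\<dots> = Z ^ q + Z" using q_ge_2 by simp
  also have "Z ^ q = hY ^ q - [:[:b ^ q:]:]" unfolding Z_def by (simp add: freshman_diff cpow)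
  also have "\<dots> + Z = hY ^ q + hY - [:[:b ^ q + b:]:]" by (simp add: Z_def)
  also have "\<dots> = hermH q + (hX ^ (q + 1) - [:[:a ^ (q + 1):]:])" unfolding ab hermH_def by simp
  also have "hX ^ (q + 1) - [:[:a ^ (q + 1):]:] = [:[:- a, 1:]:] * [:t:]"
    using t unfolding hX_power by simp
  finally have "eqR q (Z * U) ([:[:- a, 1:]:] ^ 1 * [:t:])" by (simp add: eqR_def)
  moreover have "evalH U P = 1" using q_ge_2 by (simp add: U_def Z_def P)
  ultimately show ?thesis unfolding vanishes_def P Z_def
    by (intro exI[of _ U] exI[of _ "[:t:]"]) (simp add: P)
qed

text \<open>The difference f(X, Y) - f(X, b) is a multiple of Y - b, and f(X, b) is a multiple of X
  - a once f(a, b) = 0; both generators vanish to order 1.\<close>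

lemma vanishes_of_eval:
  assumes "P \<in> hermPts q" "evalH f P = 0" shows "vanishes 1 f P"
proof -
  let ?b = "[:snd P:]"
  have "[:- ?b, 1:] dvd f - [:poly f ?b:]" unfolding poly_eq_0_iff_dvd[symmetric] by simp
  then obtain g where g: "f - [:poly f ?b:] = [:- ?b, 1:] * g" by (elim dvdE)
  have "[:- fst P, 1:] dvd poly f ?b"
    using assms(2) by (simp add: poly_eq_0_iff_dvd[symmetric] evalH_def)
  then obtain h where h: "poly f ?b = [:- fst P, 1:] * h" by (elim dvdE)
  have "f = g * (hY - [:[:snd P:]:]) + [:h:] * (hX - [:[:fst P:]:])"
    using g h by (simp add: hX_def hY_def algebra_simps)
  then show ?thesis
    using vanishes_add vanishes_mult_left vanishes_X vanishes_Y[OF assms(1)] by metis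
qed

text \<open>Every generator (X - a)^k (Y - b)^(s - k) of the ideal power vanishes to order s, since
  each of its s linear factors vanishes to order 1.\<close>

lemma vanishes_of_val_ge:
  assumes "P \<in> hermPts q" "val_ge q f P s" shows "vanishes s f P"
proof -
  obtain gs where gs: "eqR q f (\<Sum>k\<le>s. gs k * (hX - [:[:fst P:]:]) ^ k * (hY - [:[:snd P:]:]) ^ (s - k))"
    using assms(2) unfolding val_ge_def by blast
  show ?thesis
  proof (rule vanishes_cong[OF vanishes_sum gs])
    fix k assume "k \<in> {..s}"
    then have "vanishes (k + (s - k)) ((gs k * (hX - [:[:fst P:]:]) ^ k) * (hY - [:[:snd P:]:]) ^ (s - k)) P"
      using vanishes_Y[OF assms(1)]
      by (intro vanishes_mult vanishes_mult_left vanishes_one_power vanishes_X)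
    with \<open>k \<in> {..s}\<close>
    show "vanishes s (gs k * (hX - [:[:fst P:]:]) ^ k * (hY - [:[:snd P:]:]) ^ (s - k)) P" by simp
  qed
qed

section \<open>From local vanishing to divisibility by powers of G\<close>

lemma dvd_of_fibre_zeros:
  fixes a :: 'a
  assumes "\<And>b. (a, b) \<in> hermPts q \<Longrightarrow> evalH w (a, b) = 0" "inR q w"
  shows "\<exists>w'. w = [:[:- a, 1:]:] * w'"
proof -
  define v where "v = map_poly (\<lambda>c. poly c a) w"
  have v: "poly v b = evalH w (a, b)" for b
  proof -
    have "poly v b = (\<Sum>i\<le>degree w. poly (coeff w i) a * b ^ i)"
    proof -
      have "degree v \<le> degree w" unfolding v_def by (rule map_poly_degree_leq)
      then have "poly v b = (\<Sum>i\<le>degree w. coeff v i * b ^ i)"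
        unfolding poly_altdef by (intro sum.mono_neutral_left) (auto simp: coeff_eq_0)
      then show ?thesis by (simp add: v_def coeff_map_poly)
    qed
    also have "\<dots> = evalH w (a, b)"
      by (simp add: evalH_def poly_altdef[of w] poly_sum)
    finally show ?thesis .
  qed
  \<comment> \<open>Setting X = a in a reduced element leaves a polynomial in Y of degree below q,
    but the fibre over a supplies at least q roots.\<close>
  have "v = 0"
  proof (rule poly_eqI_degree[of "{b. (a, b) \<in> hermPts q}"])
    show "poly v b = poly 0 b" if "b \<in> {b. (a, b) \<in> hermPts q}" for b
      using that assms(1) by (simp add: v)
    show "degree v < card {b. (a, b) \<in> hermPts q}" "degree (0 :: 'a poly) < card {b. (a, b) \<in> hermPts q}"
      using card_fibre[of a] assms(2) map_poly_degree_leq[of "\<lambda>c. poly c a" w] q_ge_2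
      unfolding inR_def v_def[symmetric] by auto
  qed
  then have "poly (coeff w i) a = 0" for i
    by (metis v_def coeff_map_poly coeff_0 poly_0)
  then have "[:- a, 1:] dvd coeff w i" for i by (simp add: poly_eq_0_iff_dvd)
  then have "[:[:- a, 1:]:] dvd w" by (simp add: const_poly_dvd_iff)
  then show ?thesis by (elim dvdE) blast
qed

text \<open>In the step, (X - a)^k is already split off. Cancelling it in the local relation gives
  w' U = (X - a) t with U nonzero at the point, so the cofactor w' is zero on the whole fibre and
  one more X - a divides it.\<close>

lemma dvd_of_fibre_vanishes:
  "(\<And>b. (a, b) \<in> hermPts q \<Longrightarrow> vanishes k w (a, b)) \<Longrightarrow> \<exists>w'. eqR q w ([:[:- a, 1:]:] ^ k * w')"
proof (induction k)
  case 0
  show ?case by (rule exI[of _ w]) simp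
next
  case (Suc k)
  let ?x = "[:[:- a, 1:]:] :: 'a poly poly"
  have xk: "?x ^ k = [:[:- a, 1:] ^ k:]" by (induction k) (simp_all add: pCons_one)
  obtain w' where w': "eqR q w (?x ^ k * w')"
    using Suc.IH Suc.prems vanishes_mono[of "Suc k"] by (metis lessI less_imp_le)
  have "\<exists>w''. red q w' = ?x * w''"
  proof (rule dvd_of_fibre_zeros)
    show "inR q (red q w')" by (rule inR_red[OF q_ge_2])
    fix b assume P: "(a, b) \<in> hermPts q"
    obtain U t where U: "evalH U (a, b) \<noteq> 0" and t: "eqR q (w * U) (?x ^ Suc k * t)"
      using Suc.prems[OF P] unfolding vanishes_def by auto
    have "eqR q (?x ^ k * w' * U) (?x ^ Suc k * t)"
      using eqR_trans[OF eqR_mult[OF eqR_sym[OF w'] eqR_refl] t] .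
    then have "eqR q (w' * U * [:[:- a, 1:] ^ k:]) (?x * t * [:[:- a, 1:] ^ k:])"
      unfolding power_Suc xk by (simp only: mult_ac)
    then have "eqR q (w' * U) (?x * t)"
      by (rule eqR_cancel_const[OF q_ge_2]) simp
    from evalH_cong[OF this P] have "evalH w' (a, b) = 0"
      using U unfolding evalH_simps by simp
    then show "evalH (red q w') (a, b) = 0"
      using evalH_cong[OF eqR_red[OF q_ge_2, of w'] P] by simp
  qed
  then obtain w'' where "red q w' = ?x * w''" by blast
  then have "eqR q w' (?x * w'')" using eqR_red[OF q_ge_2, of w'] by simp
  from eqR_trans[OF w' eqR_mult[OF eqR_refl this]]
  have "eqR q w (?x ^ Suc k * w'')" by (simp only: power_Suc mult_ac)
  then show ?case by blast
qed

text \<open>Powers of distinct linear factors are coprime: the product over \<open>A\<close> has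
  order 0 at a new root b, so the multiplicity of b must sit in the cofactor.\<close>

lemma prod_linear_power_dvd:
  fixes c :: "'b::field poly"
  assumes "finite A" "\<And>a. a \<in> A \<Longrightarrow> [:- a, 1:] ^ k dvd c"
  shows "(\<Prod>a\<in>A. [:- a, 1:] ^ k) dvd c"
  using assms
proof (induction A rule: finite_induct)
  case (insert b A)
  then obtain d where d: "c = (\<Prod>a\<in>A. [:- a, 1:] ^ k) * d" by (auto elim: dvdE)
  have "poly (\<Prod>a\<in>A. [:- a, 1:] ^ k) b \<noteq> 0" using insert.hyps by (auto simp: poly_prod)
  then have "order b (\<Prod>a\<in>A. [:- a, 1:] ^ k) = 0" by (rule order_0I)
  moreover have "[:- b, 1:] ^ k dvd (\<Prod>a\<in>A. [:- a, 1:] ^ k) * d" using insert.prems d by auto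
  ultimately have "[:- b, 1:] ^ k dvd d"
    using insert.hyps by (cases "d = 0") (auto simp: order_divides order_mult)
  then show ?case using insert.hyps d by (simp add: mult.commute)
qed auto

text \<open>This is X^(q^2) - X (see \<open>hermG_eq\<close>), kept in factored form so that
  divisibility can be tested one root at a time.\<close>

definition gpoly :: "'a poly" where "gpoly = (\<Prod>a\<in>UNIV. [:- a, 1:])"

lemma degree_gpoly: "degree gpoly = q ^ 2"
  unfolding gpoly_def by (subst degree_prod_eq_sum_degree) (auto simp: card_field)

lemma gpoly_nz: "gpoly \<noteq> 0"
  by (simp add: gpoly_def)

text \<open>Two monic polynomials of degree q^2 that agree at all q^2 field elements are
  equal.\<close>

lemma hermG_eq: "hermG q = [:gpoly:]"
proof -
  have "monom 1 (q ^ 2) - monom 1 1 = gpoly"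
  proof (rule poly_eqI_degree_lead_coeff)
    have "lead_coeff gpoly = 1" unfolding gpoly_def by (simp add: lead_coeff_prod)
    moreover have "1 \<noteq> q ^ 2" using q_ge_2 by (auto simp: power2_eq_square)
    ultimately show "coeff (monom 1 (q ^ 2) - monom 1 1) (q ^ 2) = coeff gpoly (q ^ 2)"
      by (simp add: degree_gpoly)
    show "q ^ 2 \<le> card (UNIV :: 'a set)" by (simp add: card_field)
    have "1 \<le> q ^ 2" using q_ge_2 by simp
    then show "degree (monom (1 :: 'a) (q ^ 2) - monom 1 1) \<le> q ^ 2"
      by (intro degree_diff_le degree_monom_le order.trans[OF degree_monom_le]) auto
    show "poly (monom 1 (q ^ 2) - monom 1 1) z = poly gpoly z" for z
      by (auto simp: poly_monom power_q2 gpoly_def poly_prod)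
  qed (simp add: degree_gpoly)
  then show ?thesis unfolding hermG_def hX_power unfolding hX_eq by simp
qed

text \<open>Divisibility by each (X - a)^k is read off the Y-coefficients of the reduced form, where
  the coprime factors combine to G^k. The Y-degree does not change, so the quotient is reduced as
  well.\<close>

lemma hermG_dvd_of_vanishes:
  assumes "\<And>P. P \<in> hermPts q \<Longrightarrow> vanishes k w P"
  shows "\<exists>u. inR q u \<and> red q w = u * [:gpoly ^ k:]"
proof -
  have "[:- a, 1:] ^ k dvd coeff (red q w) j" for a j
  proof -
    obtain w' where w': "eqR q w ([:[:- a, 1:]:] ^ k * w')"
      using dvd_of_fibre_vanishes assms by blast
    have "eqR q w ([:[:- a, 1:] ^ k:] * red q w')"
      using eqR_trans[OF w' eqR_mult[OF eqR_refl eqR_red[OF q_ge_2]]] by (simp only: poly_const_pow)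
    then have "red q w = red q w' * [:[:- a, 1:] ^ k:]"
      by (intro red_eqI q_ge_2 inR_mult_const inR_red) (simp only: mult.commute)
    then show ?thesis by (simp only: coeff_mult_const dvd_triv_right)
  qed
  then have "gpoly ^ k dvd coeff (red q w) j" for j
    unfolding gpoly_def prod_power_distrib by (intro prod_linear_power_dvd) auto
  then have "[:gpoly ^ k:] dvd red q w" by (simp add: const_poly_dvd_iff)
  then obtain u where u: "red q w = u * [:gpoly ^ k:]" by (metis dvdE mult.commute)
  have "inR q u"
  proof -
    have "degree (red q w) = degree u" unfolding u using gpoly_nz by simp
    then show ?thesis using inR_red[OF q_ge_2, of w] by (simp add: inR_def)
  qed
  with u show ?thesis by blast
qed

end

section \<open>Multi-indices\<close>

lemma finite_multi_indices: "finite {j \<in> mi h. absm h j \<le> l}"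
proof (rule finite_subset)
  show "finite {f. \<forall>x. (x \<in> {..<h} \<longrightarrow> f x \<in> {..l}) \<and> (x \<notin> {..<h} \<longrightarrow> f x = 0)}"
    by (rule finite_set_of_finite_funs) auto
  have "j x \<le> absm h j" if "x < h" for j x
    unfolding absm_def using that by (intro member_le_sum) auto
  then show "{j \<in> mi h. absm h j \<le> l} \<subseteq>
      {f. \<forall>x. (x \<in> {..<h} \<longrightarrow> f x \<in> {..l}) \<and> (x \<notin> {..<h} \<longrightarrow> f x = 0)}"
    by (auto simp: mi_def intro: order.trans)
qed

lemma finite_Iset [simp]: "finite (Iset h s)"
  by (rule finite_subset[OF _ finite_multi_indices[of h s]]) (auto simp: Iset_def)

lemma finite_Jset [simp]: "finite (Jset h l)"
  by (rule finite_subset[OF _ finite_multi_indices[of h l]]) (auto simp: Jset_def)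

lemma absm_mono: "(\<And>\<mu>. \<mu> < h \<Longrightarrow> i \<mu> \<le> j \<mu>) \<Longrightarrow> absm h i \<le> absm h j"
  unfolding absm_def by (rule sum_mono) simp

lemma multibinomial:
  fixes D R :: "nat \<Rightarrow> 'b::comm_ring_1"
  shows "(\<Prod>\<mu><h. (D \<mu> + R \<mu>) ^ j \<mu>) =
    (\<Sum>i\<in>{i \<in> mi h. \<forall>\<mu><h. i \<mu> \<le> j \<mu>}.
       of_nat (\<Prod>\<mu><h. j \<mu> choose i \<mu>) * (\<Prod>\<mu><h. R \<mu> ^ (j \<mu> - i \<mu>)) * (\<Prod>\<mu><h. D \<mu> ^ i \<mu>))"
proof -
  have "(\<Prod>\<mu><h. (D \<mu> + R \<mu>) ^ j \<mu>) =
      (\<Prod>\<mu><h. \<Sum>k\<le>j \<mu>. of_nat (j \<mu> choose k) * D \<mu> ^ k * R \<mu> ^ (j \<mu> - k))"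
    by (simp add: binomial_ring)
  also have "\<dots> = (\<Sum>i\<in>PiE {..<h} (\<lambda>\<mu>. {..j \<mu>}).
      \<Prod>\<mu><h. of_nat (j \<mu> choose i \<mu>) * D \<mu> ^ i \<mu> * R \<mu> ^ (j \<mu> - i \<mu>))"
    by (rule prod_sum_PiE) auto
  also have "\<dots> = (\<Sum>i\<in>{i \<in> mi h. \<forall>\<mu><h. i \<mu> \<le> j \<mu>}.
      \<Prod>\<mu><h. of_nat (j \<mu> choose i \<mu>) * D \<mu> ^ i \<mu> * R \<mu> ^ (j \<mu> - i \<mu>))"
    \<comment> \<open>The bijection only changes the default outside {..<h}:
      \<open>undefined\<close> for elements of \<open>PiE\<close>, 0 for elements of
      \<open>mi h\<close>.\<close>
    by (rule sum.reindex_bij_witness[of _ "\<lambda>i. restrict i {..<h}" "\<lambda>i \<mu>. if \<mu> < h then i \<mu> else 0"])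
      (auto simp: mi_def fun_eq_iff PiE_iff extensional_def not_less)
  finally show ?thesis by (simp add: prod.distrib mult_ac)
qed

context hermitian_curve
begin

section \<open>The solution coming from the transmitted codeword\<close>

lemma vanishes_prod:
  "finite A \<Longrightarrow> (\<And>x. x \<in> A \<Longrightarrow> vanishes (k x) (f x) P) \<Longrightarrow> vanishes (sum k A) (prod f A) P"
  by (induction A rule: finite_induct) (auto intro: vanishes_0 vanishes_mult)

lemma val_ge_const_mult: "val_ge q L P s \<Longrightarrow> val_ge q (L * c) P s"
  unfolding val_ge_def
proof (elim exE)
  fix gs
  assume "eqR q L (\<Sum>k\<le>s. gs k * (hX - [:[:fst P:]:]) ^ k * (hY - [:[:snd P:]:]) ^ (s - k))"
  from eqR_mult[OF this eqR_refl[of q c]]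
  show "\<exists>gs. eqR q (L * c) (\<Sum>k\<le>s. gs k * (hX - [:[:fst P:]:]) ^ k * (hY - [:[:snd P:]:]) ^ (s - k))"
    by (intro exI[of _ "\<lambda>k. gs k * c"]) (simp add: sum_distrib_left sum_distrib_right mult_ac)
qed

text \<open>G^s has order at least s at every point, so the minimum defining \<open>tauH\<close>
  ranges over a nonempty set.\<close>

lemma val_ge_gpoly_power: "val_ge q [:gpoly ^ s:] P s"
proof -
  have "[:- fst P, 1:] dvd gpoly" unfolding gpoly_def by (rule dvd_prodI) auto
  then obtain t where t: "gpoly = [:- fst P, 1:] * t" by (elim dvdE)
  have "[:gpoly ^ s:] = [:t ^ s:] * (hX - [:[:fst P:]:]) ^ s"
    unfolding t power_mult_distrib hX_def by (simp add: poly_const_pow mult.commute)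
  also have "\<dots> = (\<Sum>k\<le>s. (if k = s then [:t ^ s:] else 0) *
      (hX - [:[:fst P:]:]) ^ k * (hY - [:[:snd P:]:]) ^ (s - k))"
    by (simp add: if_distrib[of "\<lambda>x. x * _"] cong: if_cong)
  finally show ?thesis unfolding val_ge_def
    by (intro exI[of _ "\<lambda>k. if k = s then [:t ^ s:] else 0"]) simp
qed

lemma ex_locator:
  fixes e :: "nat \<Rightarrow> 'a \<times> 'a \<Rightarrow> 'a"
  obtains L where "monicH q L" "degH q L = tauH q h s e" "\<And>P. P \<in> errset q h e \<Longrightarrow> val_ge q L P s"
proof -
  let ?Q = "\<lambda>d. \<exists>L :: 'a poly poly. inR q L \<and> L \<noteq> 0 \<and> degH q L = d \<and> (\<forall>P \<in> errset q h e. val_ge q L P s)"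
  have "inR q [:gpoly ^ s:]" "[:gpoly ^ s:] \<noteq> 0"
    using q_ge_2 gpoly_nz by (auto simp: inR_def)
  then have "?Q (degH q [:gpoly ^ s:])" using val_ge_gpoly_power by blast
  then have "?Q (tauH q h s e)" unfolding tauH_def by (rule LeastI)
  then obtain L :: "'a poly poly" where L: "inR q L" "L \<noteq> 0" "degH q L = tauH q h s e"
    and val: "\<And>P. P \<in> errset q h e \<Longrightarrow> val_ge q L P s" by blast
  obtain i j where ij: "coeff (coeff L j) i \<noteq> 0" "i * q + j * (q + 1) = degH q L"
    using degH_attained[OF L(2)] by blast
  \<comment> \<open>Scaling by the inverse of the leading coefficient keeps the support, hence the
    degree.\<close>
  define c where "c = inverse (coeff (coeff L j) i)"
  define L' where "L' = L * [:[:c:]:]"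
  have co: "coeff (coeff L' k) m = coeff (coeff L k) m * c" for k m
    unfolding L'_def coeff_mult_const by simp
  have c1: "coeff (coeff L' j) i = 1" unfolding co c_def using ij by simp
  have "degH_le q L' (int (degH q L))"
    using degH_le_degH[of q L] unfolding degH_le_def co by auto
  from degH_eqI[OF this _ ij(2)] have d: "degH q L' = degH q L" using c1 by simp
  have "monicH q L'" unfolding monicH_def
    using c1 ij(2) d L(1) by (auto simp: L'_def simp del: mult_pCons_right intro!: inR_mult_const)
  then show thesis using that[of L'] d L(3) val val_ge_const_mult unfolding L'_def by metis
qed

lemma transmitted_solution:
  fixes f R :: "nat \<Rightarrow> 'a poly poly" and e :: "nat \<Rightarrow> 'a \<times> 'a \<Rightarrow> 'a"
  assumes mH: "mH < q ^ 3"
    and f: "\<forall>i<h. inR q (f i) \<and> degH_le q (f i) (int mH)"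
    and R: "\<forall>\<mu><h. inR q (R \<mu>) \<and> degH_le q (R \<mu>) (int (q ^ 3 + 2 * hermg q) - 1) \<and>
            (\<forall>P\<in>hermPts q. evalH (R \<mu>) P = evalH (f \<mu>) P + e \<mu> P)"
    and s: "0 < s"
    and L: "monicH q L" "\<And>P. P \<in> errset q h e \<Longrightarrow> val_ge q L P s"
  obtains lam psi where "is_solution q h mH s l R lam psi" "lam (\<lambda>_. 0) = L"
proof -
  define D where "D \<mu> = f \<mu> - R \<mu>" for \<mu>
  define Dp where "Dp i = (\<Prod>\<mu><h. D \<mu> ^ i \<mu>)" for i :: "nat \<Rightarrow> nat"
  define \<tau> where "\<tau> = int (degH q L)"
  \<comment> \<open>At error positions \<open>L\<close> alone contributes order s; elsewhere the
    factors of \<open>Dp i\<close> contribute |i| in total. The case k = |i| < s yields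
    \<open>lam i\<close>, the case k = s \<le> |i| the congruences modulo G^s.\<close>
  have van: "vanishes k (L * Dp i) P" if "k \<le> s" "k \<le> absm h i" "P \<in> hermPts q" for k i P
  proof (cases "P \<in> errset q h e")
    case True
    then have "vanishes s L P" using L(2) that(3) vanishes_of_val_ge by blast
    then show ?thesis using vanishes_mono[OF vanishes_mult_left, of s L P k "Dp i"] that(1)
      by (simp add: mult.commute)
  next
    case False
    have "vanishes (i \<mu>) (D \<mu> ^ i \<mu>) P" if "\<mu> < h" for \<mu>
    proof -
      have "e \<mu> P = 0" using False \<open>P \<in> hermPts q\<close> that by (auto simp: errset_def)
      then have "evalH (D \<mu>) P = 0" using R that \<open>P \<in> hermPts q\<close> by (simp add: D_def)
      then show ?thesis using \<open>P \<in> hermPts q\<close> by (intro vanishes_one_power vanishes_of_eval)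
    qed
    then have "vanishes (absm h i) (Dp i) P"
      unfolding absm_def Dp_def by (intro vanishes_prod) auto
    then show ?thesis using vanishes_mono[OF _ that(2)] vanishes_mult_left by blast
  qed
  have "\<forall>i\<in>Iset h s. \<exists>u. inR q u \<and> red q (L * Dp i) = u * [:gpoly ^ absm h i:]"
    using van by (intro ballI hermG_dvd_of_vanishes) (auto simp: Iset_def)
  then obtain lam where lam: "\<And>i. i \<in> Iset h s \<Longrightarrow> inR q (lam i)"
    "\<And>i. i \<in> Iset h s \<Longrightarrow> red q (L * Dp i) = lam i * [:gpoly ^ absm h i:]" by metis
  define psi where "psi j = red q (L * (\<Prod>\<mu><h. f \<mu> ^ j \<mu>))" for j :: "nat \<Rightarrow> nat"
  have Gpow: "hermG q ^ k = [:gpoly ^ k:]" for k by (simp add: hermG_eq poly_const_pow)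
  have lamG: "eqR q (L * Dp i) (lam i * hermG q ^ absm h i)" if "i \<in> Iset h s" for i
    using eqR_red[OF q_ge_2, of "L * Dp i"] lam(2)[OF that] by (simp only: Gpow)

  define B where "B i j = of_nat (\<Prod>\<mu><h. j \<mu> choose i \<mu>) * (\<Prod>\<mu><h. R \<mu> ^ (j \<mu> - i \<mu>))"
    for i j :: "nat \<Rightarrow> nat"
  define below where "below j = {i \<in> mi h. \<forall>\<mu><h. i \<mu> \<le> j \<mu>}" for j :: "nat \<Rightarrow> nat"
  have fin: "finite (below j)" for j
    by (rule finite_subset[OF _ finite_multi_indices[of h "absm h j"]])
      (auto simp: below_def intro: absm_mono)
  \<comment> \<open>The binomial expansion is cut at |i| = s. The lower part is the sum of the key
    equation, as \<open>Aent\<close> is 0 unless i is componentwise below j; the rest is a tail to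
    be killed modulo G^s.\<close>
  have split: "eqR q (psi j) ((\<Sum>i\<in>Iset h s. lam i * Aent q h R i j) +
      (\<Sum>i\<in>below j - Iset h s. B i j * (L * Dp i)))" for j
  proof -
    have "L * (\<Prod>\<mu><h. f \<mu> ^ j \<mu>) = L * (\<Prod>\<mu><h. (D \<mu> + R \<mu>) ^ j \<mu>)" by (simp add: D_def)
    also have "\<dots> = (\<Sum>i\<in>below j. B i j * (L * Dp i))"
      unfolding multibinomial sum_distrib_left B_def Dp_def below_def
      by (intro sum.cong) (auto simp: mult_ac)
    also have "\<dots> = (\<Sum>i\<in>below j \<inter> Iset h s. B i j * (L * Dp i)) +
        (\<Sum>i\<in>below j - Iset h s. B i j * (L * Dp i))"
      using sum.Int_Diff[OF fin] by blast
    finally have 1: "eqR q (psi j) \<dots>"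
      unfolding psi_def using eqR_sym[OF eqR_red[OF q_ge_2]] by metis
    have "eqR q (\<Sum>i\<in>below j \<inter> Iset h s. B i j * (L * Dp i))
        (\<Sum>i\<in>below j \<inter> Iset h s. B i j * (lam i * hermG q ^ absm h i))"
      by (intro eqR_sum eqR_mult eqR_refl lamG) auto
    also have "(\<Sum>i\<in>below j \<inter> Iset h s. B i j * (lam i * hermG q ^ absm h i)) =
        (\<Sum>i\<in>below j \<inter> Iset h s. lam i * Aent q h R i j)"
      by (intro sum.cong) (auto simp: Aent_def B_def below_def mult_ac)
    also have "\<dots> = (\<Sum>i\<in>Iset h s. lam i * Aent q h R i j)"
      by (intro sum.mono_neutral_left finite_Iset) (auto simp: Aent_def below_def Iset_def)
    finally show ?thesis using eqR_trans[OF 1 eqR_add[OF _ eqR_refl]] by blast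
  qed

  have L0: "lam (\<lambda>_. 0) = L"
  proof -
    have "(\<lambda>_. 0) \<in> Iset h s" using s by (simp add: Iset_def mi_def absm_def)
    from lam(2)[OF this] have "red q L = lam (\<lambda>_. 0)" by (simp add: Dp_def absm_def)
    moreover have "red q L = L" using L(1) by (intro red_eqI q_ge_2) (auto simp: monicH_def)
    ultimately show ?thesis by simp
  qed
  have "is_solution q h mH s l R lam psi" unfolding is_solution_def L0
  proof (intro conjI ballI impI)
    show "inR q (lam i)" if "i \<in> Iset h s" for i using lam(1)[OF that] .
    show "inR q (psi j)" for j unfolding psi_def by (rule inR_red[OF q_ge_2])
    show "monicH q L" by fact
    show "eqR q (psi j) (\<Sum>i\<in>Iset h s. lam i * Aent q h R i j)" if "absm h j < s" for j
    proof -
      \<comment> \<open>If |j| < s, every i below j has |i| < s, so there is no tail.\<close>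
      have *: "below j - Iset h s = {}"
        using that le_less_trans[OF absm_mono] unfolding below_def Iset_def by blast
      show ?thesis using split[of j] unfolding * by simp
    qed
    show "congR q (psi j) (\<Sum>i\<in>Iset h s. lam i * Aent q h R i j) (hermG q ^ s)" for j
    proof -
      have "\<forall>i\<in>below j - Iset h s. \<exists>u. red q (L * Dp i) = u * [:gpoly ^ s:]"
      proof
        fix i assume "i \<in> below j - Iset h s"
        then have "s \<le> absm h i" by (auto simp: below_def Iset_def)
        then have "\<exists>u. inR q u \<and> red q (L * Dp i) = u * [:gpoly ^ s:]"
          by (intro hermG_dvd_of_vanishes van) auto
        then show "\<exists>u. red q (L * Dp i) = u * [:gpoly ^ s:]" by blast
      qed
      then obtain u where u: "\<And>i. i \<in> below j - Iset h s \<Longrightarrow> red q (L * Dp i) = u i * [:gpoly ^ s:]"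
        by metis
      have "eqR q (\<Sum>i\<in>below j - Iset h s. B i j * (L * Dp i))
          (\<Sum>i\<in>below j - Iset h s. B i j * red q (L * Dp i))"
        by (intro eqR_sum eqR_mult eqR_refl eqR_red q_ge_2)
      also have "\<dots> = (\<Sum>i\<in>below j - Iset h s. B i j * (u i * hermG q ^ s))"
        by (rule sum.cong[OF refl]) (simp only: u Gpow)
      also have "\<dots> = (\<Sum>i\<in>below j - Iset h s. B i j * u i) * hermG q ^ s"
        by (simp add: sum_distrib_left sum_distrib_right mult_ac)
      finally show ?thesis unfolding congR_def
        using eqR_trans[OF split eqR_add[OF eqR_refl]] by blast
    qed
    show "degH_le q (lam i) (int (degH q L) + int (absm h i) * (2 * int (hermg q) - 1))"
      if "i \<in> Iset h s" for i
    proof -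
      let ?d = "int (q ^ 3 + 2 * hermg q) - 1"
      have "degH_le q (D \<mu>) ?d" if "\<mu> < h" for \<mu>
      proof -
        have "int mH \<le> ?d" using mH by linarith
        then show ?thesis unfolding D_def using f R that by (intro degH_le_diff) (auto intro: degH_le_mono)
      qed
      then have "degH_le q (Dp i) (\<Sum>\<mu><h. int (i \<mu>) * ?d)"
        unfolding Dp_def by (intro degH_le_prod degH_le_power) auto
      then have "degH_le q (red q (L * Dp i)) (\<tau> + (\<Sum>\<mu><h. int (i \<mu>) * ?d))"
        unfolding \<tau>_def by (intro degH_le_red q_ge_2 degH_le_mult degH_le_degH)
      also have "(\<Sum>\<mu><h. int (i \<mu>) * ?d) = int (absm h i) * ?d"
        unfolding absm_def of_nat_sum sum_distrib_right ..
      finally have "degH_le q (lam i) (\<tau> + int (absm h i) * ?d - int (q * degree (gpoly ^ absm h i)))"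
        unfolding lam(2)[OF that] by (rule degH_le_cancel_const) (simp add: gpoly_nz)
      \<comment> \<open>Each factor G removes weight q * q^2 = n, and each factor of
        \<open>Dp i\<close> brings at most n + 2g - 1; what remains per unit of |i| is 2g -
        1.\<close>
      also have "\<tau> + int (absm h i) * ?d - int (q * degree (gpoly ^ absm h i)) =
          \<tau> + int (absm h i) * (2 * int (hermg q) - 1)"
        by (simp add: degree_power_eq gpoly_nz degree_gpoly algebra_simps power2_eq_square power3_eq_cube)
      finally show ?thesis unfolding \<tau>_def .
    qed
    show "degH_le q (psi j) (int (degH q L) + int (absm h j) * int mH)" for j
    proof -
      have "degH_le q (\<Prod>\<mu><h. f \<mu> ^ j \<mu>) (\<Sum>\<mu><h. int (j \<mu>) * int mH)"
        using f by (intro degH_le_prod degH_le_power) auto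
      then have "degH_le q (psi j) (int (degH q L) + (\<Sum>\<mu><h. int (j \<mu>) * int mH))"
        unfolding psi_def by (intro degH_le_red q_ge_2 degH_le_mult degH_le_degH)
      then show ?thesis unfolding absm_def of_nat_sum sum_distrib_right .
    qed
  qed
  then show thesis using that L0 by blast
qed

end

section \<open>Counting\<close>

text \<open>The involution \<open>j\<^sub>\<mu> \<mapsto> l - |j|\<close> exchanges the \<open>\<mu>\<close>-th entry with the slack \<open>l - |j|\<close>.\<close>

lemma sum_absm_le: "(h + 1) * (\<Sum>j\<in>{j \<in> mi h. absm h j \<le> l}. absm h j) = h * l * Cle h l"
proof -
  let ?S = "{j \<in> mi h. absm h j \<le> l}"
  have upd: "absm h (j(\<mu> := l - absm h j)) + j \<mu> = l" if "\<mu> < h" "j \<in> ?S" for \<mu> j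
  proof -
    have "absm h (j(\<mu> := x)) = x + (\<Sum>\<nu>\<in>{..<h} - {\<mu>}. j \<nu>)" for x
    proof -
      have "absm h (j(\<mu> := x)) = (j(\<mu> := x)) \<mu> + (\<Sum>\<nu>\<in>{..<h} - {\<mu>}. (j(\<mu> := x)) \<nu>)"
        unfolding absm_def using that by (intro sum.remove) auto
      also have "(\<Sum>\<nu>\<in>{..<h} - {\<mu>}. (j(\<mu> := x)) \<nu>) = (\<Sum>\<nu>\<in>{..<h} - {\<mu>}. j \<nu>)"
        by (intro sum.cong) auto
      finally show ?thesis unfolding fun_upd_same .
    qed
    from this[of "l - absm h j"] this[of "j \<mu>"] show ?thesis using that by simp
  qed
  have slack: "(\<Sum>j\<in>?S. j \<mu>) = (\<Sum>j\<in>?S. l - absm h j)" if "\<mu> < h" for \<mu>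
  proof -
    define u where "u j = j(\<mu> := l - absm h j)" for j
    have "u (u j) = j \<and> u j \<in> ?S \<and> l - absm h (u j) = j \<mu>" if j: "j \<in> ?S" for j
    proof -
      have a: "absm h (u j) = l - j \<mu>" and b: "j \<mu> \<le> l"
        using upd[OF \<open>\<mu> < h\<close> j] unfolding u_def by linarith+
      have "u (u j) = j(\<mu> := l - absm h (u j))" by (simp add: u_def)
      then have "u (u j) = j" unfolding a using b by simp
      moreover have "u j \<in> mi h" using j \<open>\<mu> < h\<close> by (simp add: u_def mi_def)
      ultimately show ?thesis using a b by simp
    qed
    then show ?thesis by (intro sum.reindex_bij_witness[of _ u u]) blast+
  qed
  \<comment> \<open>All h entries have the same total as the slack, and entries and slack add up to
    l for each index: h + 1 equal totals share l * \<open>Cle h l\<close>.\<close>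
  have "(\<Sum>j\<in>?S. absm h j) = (\<Sum>\<mu><h. \<Sum>j\<in>?S. j \<mu>)"
    unfolding absm_def by (rule sum.swap)
  also have "\<dots> = (\<Sum>\<mu><h. \<Sum>j\<in>?S. l - absm h j)"
    by (rule sum.cong[OF refl], rule slack) simp
  also have "\<dots> = h * (\<Sum>j\<in>?S. l - absm h j)" by simp
  finally have 1: "(\<Sum>j\<in>?S. absm h j) = \<dots>" .
  have "(\<Sum>j\<in>?S. l - absm h j) + (\<Sum>j\<in>?S. absm h j) = (\<Sum>j\<in>?S. l - absm h j + absm h j)"
    by (rule sum.distrib[symmetric])
  also have "\<dots> = (\<Sum>j\<in>?S. l)" by (rule sum.cong) auto
  finally have 2: "(\<Sum>j\<in>?S. l - absm h j) + (\<Sum>j\<in>?S. absm h j) = l * Cle h l"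
    unfolding Cle_def by (simp add: mult.commute)
  have "(h + 1) * x = h * l * y" if "x = h * z" "z + x = l * y" for x y z :: nat
  proof -
    have "(h + 1) * x = h * (z + x)" using that(1) by (simp add: algebra_simps)
    then show ?thesis using that(2) by simp
  qed
  from this[OF 1 2] show ?thesis .
qed

text \<open>The coefficients at positions in \<open>K\<close> are free, so \<open>card K\<close> is
  the dimension of this space. It is recorded as a cardinality for the pigeonhole argument.\<close>

lemma card_supported:
  fixes K :: "(nat \<times> nat) set"
  assumes "finite K"
  shows "card {f :: 'b::{comm_ring_1,finite} poly poly. \<forall>i j. coeff (coeff f j) i \<noteq> 0 \<longrightarrow> (i, j) \<in> K}
    = card (UNIV :: 'b set) ^ card K"
proof -
  let ?A = "{f :: 'b poly poly. \<forall>i j. coeff (coeff f j) i \<noteq> 0 \<longrightarrow> (i, j) \<in> K}"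
  define F where "F f = restrict (\<lambda>(i, j). coeff (coeff f j) i) K" for f :: "'b poly poly"
  define G where "G c = (\<Sum>k\<in>K. monom (monom (c k) (fst k)) (snd k))" for c :: "nat \<times> nat \<Rightarrow> 'b"
  have G: "coeff (coeff (G c) j) i = (if (i, j) \<in> K then c (i, j) else 0)" for c i j
  proof -
    have "coeff (coeff (G c) j) i = (\<Sum>k\<in>K. if k = (i, j) then c k else 0)"
      unfolding G_def coeff_sum by (intro sum.cong) auto
    then show ?thesis using assms by simp
  qed
  have "bij_betw F ?A (PiE K (\<lambda>_. UNIV))"
  proof (rule bij_betwI)
    show "F \<in> ?A \<rightarrow> PiE K (\<lambda>_. UNIV)" by (auto simp: F_def)
    show "G \<in> PiE K (\<lambda>_. UNIV) \<rightarrow> ?A" by (auto simp: G split: if_splits)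
    show "G (F f) = f" if "f \<in> ?A" for f
      by (intro poly_eqI) (use that in \<open>auto simp: G F_def\<close>)
    show "F (G c) = c" if "c \<in> PiE K (\<lambda>_. UNIV)" for c
    proof
      fix k show "F (G c) k = c k"
        using that by (cases k) (auto simp: F_def G PiE_def extensional_def)
    qed
  qed
  then have "card ?A = card (PiE K (\<lambda>_. UNIV :: 'b set))" by (rule bij_betw_same_card)
  then show ?thesis using assms by (simp add: card_PiE)
qed

section \<open>Dimensions of the spaces L(m P_inf)\<close>

definition weights :: "nat \<Rightarrow> nat \<Rightarrow> (nat \<times> nat) set" where
  "weights q m = {(i, j). j < q \<and> i * q + j * (q + 1) \<le> m}"

definition ldim :: "nat \<Rightarrow> nat \<Rightarrow> nat" where "ldim q m = card (weights q m)"

definition Lspace :: "nat \<Rightarrow> nat \<Rightarrow> 'a::comm_ring_1 poly poly set" where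
  "Lspace q m = {f. inR q f \<and> degH_le q f (int m)}"

lemma finite_weights: "q > 0 \<Longrightarrow> finite (weights q m)"
proof (rule finite_subset)
  assume q: "q > 0"
  show "weights q m \<subseteq> {..m} \<times> {..<q}"
  proof clarify
    fix i j assume "(i, j) \<in> weights q m"
    then have "j < q" "i * q \<le> m" by (auto simp: weights_def)
    moreover have "i * 1 \<le> i * q" using q by (intro mult_le_mono2) auto
    ultimately show "i \<in> {..m} \<and> j \<in> {..<q}"
      using order.trans[of i "i * q" m] by simp
  qed
qed auto

lemma inR_iff: "q > 0 \<Longrightarrow> inR q f \<longleftrightarrow> (\<forall>i j. coeff (coeff f j) i \<noteq> 0 \<longrightarrow> j < q)"
  unfolding inR_def
  by (metis coeff_0 le_degree leading_coeff_0_iff degree_0 le_less_trans)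

lemma Lspace_eq:
  assumes "q > 0"
  shows "Lspace q m = {f. \<forall>i j. coeff (coeff f j) i \<noteq> 0 \<longrightarrow> (i, j) \<in> weights q m}"
  unfolding Lspace_def inR_iff[OF assms] degH_le_def of_nat_le_iff weights_def by blast

lemma card_Lspace:
  "q > 0 \<Longrightarrow> card (Lspace q m :: 'a::{comm_ring_1,finite} poly poly set) = card (UNIV :: 'a set) ^ ldim q m"
  unfolding Lspace_eq ldim_def by (intro card_supported finite_weights)

text \<open>The weight is congruent to j modulo q, which determines j < q and then i: distinct basis
  monomials have distinct pole orders.\<close>

lemma inj_on_weight: "inj_on (\<lambda>(i, j :: nat). i * q + j * (q + 1)) {(i, j). j < q}"
proof (rule inj_onI, clarify)
  fix i j i' j' assume j: "j < q" "j' < q" and e: "i * q + j * (q + 1) = i' * q + j' * (q + 1)"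
  then have e: "j + (i + j) * q = j' + (i' + j') * q" by (simp add: algebra_simps)
  have "(j + (i + j) * q) mod q = j" "(j' + (i' + j') * q) mod q = j'" using j by simp_all
  with e have "j = j'" by metis
  then show "i = i' \<and> j = j'" using e j by simp
qed

text \<open>The dimension thus counts pole numbers up to m, which reduces estimates of it to
  inclusions between sets of integers.\<close>

lemma ldim_eq: "ldim q m = card ((\<lambda>(i, j). i * q + j * (q + 1)) ` weights q m)"
  unfolding ldim_def
  by (rule card_image[symmetric], rule inj_on_subset[OF inj_on_weight]) (auto simp: weights_def)

text \<open>Raising the bound by one admits at most one new pole number.\<close>

lemma ldim_le: 
  assumes "q > 0" "b \<le> a" shows "ldim q a \<le> ldim q b + (a - b)"
proof -
  let ?w = "\<lambda>(i, j). i * q + j * (q + 1)"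
  have "?w ` weights q a \<subseteq> ?w ` weights q b \<union> {b<..a}"
    by (force simp: weights_def)
  then have "ldim q a \<le> card (?w ` weights q b \<union> {b<..a})"
    unfolding ldim_eq using assms by (intro card_mono) (auto intro: finite_weights)
  also have "\<dots> \<le> ldim q b + (a - b)" 
    using card_Un_le[of "?w ` weights q b" "{b<..a}"] unfolding ldim_eq by simp
  finally show ?thesis .
qed

text \<open>Riemann's inequality: the gaps of the semigroup generated by \<open>q\<close> and \<open>q + 1\<close> are
  the numbers \<open>t q + j\<close> with \<open>t < j < q\<close>.\<close>

lemma ldim_ge:
  assumes "q > 0" shows "m + 1 \<le> ldim q m + hermg q"
proof -
  let ?w = "\<lambda>(i, j). i * q + j * (q + 1)"
  let ?G = "(\<lambda>(j, t). j + t * q) ` (SIGMA j:{..<q}. {..<j})"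
  have "n \<in> ?w ` weights q m \<union> ?G" if "n \<le> m" for n
  proof (cases "n div q < n mod q")
    case True
    then have "n \<in> ?G" using assms by (intro image_eqI[of _ _ "(n mod q, n div q)"]) auto
    then show ?thesis ..
  next
    case False
    \<comment> \<open>If n = t q + j with t \<ge> j, then n = (t - j) q + j (q + 1) is a pole
      number.\<close>
    define j where "j = n mod q"
    obtain i where i: "n div q = i + j" using False unfolding j_def by (metis add.commute le_iff_add not_less)
    have "n = (i + j) * q + j" by (metis div_mult_mod_eq i j_def)
    then have n: "n = i * q + j * (q + 1)" by (simp add: algebra_simps)
    moreover have "(i, j) \<in> weights q m" using n that assms by (simp add: weights_def j_def)
    ultimately show ?thesis by force
  qed
  then have "card {..m} \<le> card (?w ` weights q m \<union> ?G)"
    using assms by (intro card_mono) (auto intro: finite_weights)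
  also have "\<dots> \<le> ldim q m + card ?G" unfolding ldim_eq by (rule card_Un_le)
  also have "card ?G \<le> card (SIGMA j:{..<q}. {..<j})" by (rule card_image_le) auto
  also have "\<dots> = \<Sum>{..<q}" by (simp add: card_SigmaI)
  also have "\<dots> = hermg q"
    using gauss_sum_nat[of "q - 1"] assms
    by (cases q) (simp_all add: hermg_def lessThan_Suc_atMost atMost_atLeast0 mult.commute)
  finally show ?thesis by simp
qed

text \<open>Ensures that the natural subtraction in \<open>2 * hermg q - 1\<close> is not
  truncated.\<close>

lemma (in hermitian_curve) hermg_ge_1: "hermg q \<ge> 1"
proof -
  have "2 * 1 \<le> q * (q - 1)" using q_ge_2 by (intro mult_le_mono) auto
  then show ?thesis unfolding hermg_def by linarith
qed

text \<open>The right-hand side counts the coefficients of all \<open>\<lambda>\<^sub>i\<close> and \<open>\<psi>\<^sub>j\<close> (so the \<open>\<psi>\<^sub>j\<close> are not eliminated),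
  the left-hand side the equations; the extra one is for the coefficient of \<open>\<lambda>\<^sub>0\<close> at degree \<open>\<tau>\<close>.\<close>

lemma (in hermitian_curve) dimension_count:
  assumes h: "1 \<le> h" and mH: "mH < q ^ 3" and s: "0 < s" "s \<le> l"
    and tau: "real tau > tau_max q h mH s l"
  shows "(\<Sum>j\<in>Jset h l. if absm h j < s then ldim q (tau + absm h j * (q ^ 3 + 2 * hermg q - 1))
        else s * q ^ 3) + 1
    < (\<Sum>i\<in>Iset h s. ldim q (tau + absm h i * (2 * hermg q - 1)))
      + (\<Sum>j\<in>Jset h l. ldim q (tau + absm h j * mH))" (is "?E + 1 < ?U1 + ?U2")
proof -
  define g n where "g = int (hermg q)" and "n = int (q ^ 3)"
  define t m where "t = int tau" and "m = int mH"
  let ?C = "{j \<in> mi h. absm h j \<le> l}"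
  let ?E' = "\<lambda>j. int (if absm h j < s then ldim q (tau + absm h j * (q ^ 3 + 2 * hermg q - 1)) else s * q ^ 3)"
  let ?u = "\<lambda>j. int (ldim q (tau + absm h j * mH)) - ?E' j"
  have q: "q > 0" using q_ge_2 by simp
  have g: "hermg q \<ge> 1" by (rule hermg_ge_1)
  have zI: "(\<lambda>_. 0) \<in> Iset h s" using s by (simp add: Iset_def mi_def absm_def)
  have abs0: "absm h j = 0 \<longleftrightarrow> j = (\<lambda>_. 0)" if "j \<in> mi h" for j
    using that by (auto simp: absm_def mi_def fun_eq_iff) (meson lessThan_iff not_less)
  have IC: "Iset h s \<subseteq> ?C" using s by (auto simp: Iset_def)
  have J: "Jset h l = (Iset h s - {\<lambda>_. 0}) \<union> (?C - Iset h s)"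
  proof -
    have "1 \<le> absm h j \<longleftrightarrow> j \<noteq> (\<lambda>_. 0)" if "j \<in> mi h" for j
      using abs0[OF that] by (metis One_nat_def Suc_le_eq not_gr_zero)
    then show ?thesis using s zI by (auto simp: Jset_def Iset_def)
  qed
  have ldim: "int (ldim q x) \<ge> int x + 1 - g" for x
    using ldim_ge[OF q, of x] unfolding g_def by linarith
  have U1: "(\<Sum>i\<in>Iset h s. (t + 1 - g) + int (absm h i) * (2 * g - 1)) \<le> int ?U1"
    unfolding of_nat_sum
  proof (rule sum_mono)
    fix i
    have "int (2 * hermg q - 1) = 2 * g - 1" using g by (simp add: g_def of_nat_diff)
    then show "(t + 1 - g) + int (absm h i) * (2 * g - 1) \<le> int (ldim q (tau + absm h i * (2 * hermg q - 1)))"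
      using ldim[of "tau + absm h i * (2 * hermg q - 1)"] by (simp add: t_def)
  qed
  \<comment> \<open>For |j| < s both the unknown \<open>psi j\<close> and its equation live in
    spaces of bounded weight. Only the difference of the two bounds matters, so
    \<open>ldim_le\<close> replaces Riemann's inequality here.\<close>
  have lo: "- (int (absm h j) * (n + 2 * g - 1 - m)) \<le> ?u j" if "j \<in> Iset h s" for j
  proof -
    let ?a = "tau + absm h j * (q ^ 3 + 2 * hermg q - 1)" and ?b = "tau + absm h j * mH"
    have "mH \<le> q ^ 3 + 2 * hermg q - 1" using mH by simp
    then have ba: "?b \<le> ?a" by simp
    have "int ?a = t + int (absm h j) * (n + 2 * g - 1)" "int ?b = t + int (absm h j) * m"
      using g by (simp_all add: n_def g_def t_def m_def of_nat_diff)
    then have "int (?a - ?b) = int (absm h j) * (n + 2 * g - 1 - m)"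
      using ba by (simp only: of_nat_diff) (simp add: algebra_simps)
    then show ?thesis using ldim_le[OF q ba] that by (simp add: Iset_def)
  qed
  have hi: "(t + 1 - g - int s * n) + int (absm h j) * m \<le> ?u j" if "j \<in> ?C - Iset h s" for j
    using that ldim[of "tau + absm h j * mH"] by (simp add: Iset_def t_def m_def n_def)
  \<comment> \<open>The zero index is in \<open>Iset\<close> but not in \<open>Jset\<close>; its
    term is 0, so it can be included to make \<open>Wlt\<close> appear.\<close>
  have "(\<Sum>j\<in>Iset h s. - (int (absm h j) * (n + 2 * g - 1 - m)))
      = (\<Sum>j\<in>Iset h s - {\<lambda>_. 0}. - (int (absm h j) * (n + 2 * g - 1 - m)))"
    by (intro sum.mono_neutral_right) (auto simp: absm_def)
  also have "\<dots> \<le> sum ?u (Iset h s - {\<lambda>_. 0})" using lo by (intro sum_mono) auto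
  finally have lo_sum: "(\<Sum>j\<in>Iset h s. - (int (absm h j) * (n + 2 * g - 1 - m))) \<le> \<dots>" .
  have hi_sum: "(\<Sum>j\<in>?C - Iset h s. (t + 1 - g - int s * n) + int (absm h j) * m) \<le> sum ?u (?C - Iset h s)"
    using hi by (rule sum_mono)
  have fC: "finite ?C" by (rule finite_multi_indices)
  have "int ?U2 - int ?E = sum ?u (Jset h l)" by (simp add: sum_subtractf)
  also have "\<dots> = sum ?u (Iset h s - {\<lambda>_. 0}) + sum ?u (?C - Iset h s)"
    unfolding J using fC by (intro sum.union_disjoint) auto
  finally have U2: "int ?U2 - int ?E = \<dots>" .
  define Wle where "Wle = (\<Sum>j\<in>?C. int (absm h j))"
  define Cl Ci Wi where "Cl = int (Cle h l)" and "Ci = int (Clt h s)" and "Wi = int (Wlt h s)"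
  have sI: "(\<Sum>i\<in>Iset h s. int (absm h i)) = Wi" by (simp add: Wi_def Wlt_def)
  have cI: "int (card (Iset h s)) = Ci" by (simp add: Ci_def Clt_def)
  have sC: "(\<Sum>j\<in>?C - Iset h s. int (absm h j)) = Wle - Wi"
    unfolding Wle_def using sum_diff[OF fC IC, of "\<lambda>j. int (absm h j)"] sI by simp
  have cC: "int (card (?C - Iset h s)) = Cl - Ci"
    using card_Diff_subset[OF finite_Iset IC] card_mono[OF fC IC] by (simp add: Cl_def Cle_def Ci_def Clt_def of_nat_diff)
  have "int ?U1 + (int ?U2 - int ?E) \<ge>
      (Ci * (t + 1 - g) + Wi * (2 * g - 1)) - Wi * (n + 2 * g - 1 - m)
      + ((Cl - Ci) * (t + 1 - g - int s * n) + (Wle - Wi) * m)"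
  proof -
    have "(\<Sum>i\<in>Iset h s. (t + 1 - g) + int (absm h i) * (2 * g - 1)) = Ci * (t + 1 - g) + Wi * (2 * g - 1)"
      by (simp only: sum.distrib sum_distrib_right[symmetric] sum_constant sI cI)
    moreover have "(\<Sum>j\<in>Iset h s. - (int (absm h j) * (n + 2 * g - 1 - m))) = - (Wi * (n + 2 * g - 1 - m))"
      by (simp only: sum_negf sum_distrib_right[symmetric] sI)
    moreover have "(\<Sum>j\<in>?C - Iset h s. (t + 1 - g - int s * n) + int (absm h j) * m) =
        (Cl - Ci) * (t + 1 - g - int s * n) + (Wle - Wi) * m"
      by (simp only: sum.distrib sum_distrib_right[symmetric] sum_constant sC cC)
    ultimately show ?thesis using U1 lo_sum hi_sum U2 by linarith
  qed
  \<comment> \<open>The 2g - 1 gained by the \<open>lam i\<close> cancels the 2g - 1 lost in the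
    equations with |j| < s, both being weighted by \<open>Wi\<close>.\<close>
  then have bound: "int ?U1 + int ?U2 - int ?E \<ge>
      Cl * (t + 1 - g) - n * Wi - (Cl - Ci) * int s * n + m * Wle"
    by (simp add: algebra_simps)
  have Cpos: "Cle h l > 0"
    unfolding Cle_def using zI IC fC by (auto simp: card_gt_0_iff)
  have W: "int (h + 1) * Wle = int h * int l * Cl"
    unfolding Wle_def Cl_def using sum_absm_le[of h l] by (simp flip: of_nat_sum of_nat_mult of_nat_Suc)
  have "real_of_int (Cl * (t + 1 - g) - n * Wi - (Cl - Ci) * int s * n + m * Wle) > 1"
  proof -
    have Wr: "real_of_int Wle = real h / real (h + 1) * real l * real (Cle h l)"
    proof -
      have "real (h + 1) * real_of_int Wle = real h * real l * real (Cle h l)"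
        using arg_cong[OF W, of real_of_int] by (simp add: Cl_def)
      then show ?thesis by (simp add: field_simps)
    qed
    have "real (Cle h l) * tau_max q h mH s l =
      real (Cle h l) * real s * real (q ^ 3) - real (q ^ 3) * (real s * real (Clt h s) - real (Wlt h s))
      - real mH * real_of_int Wle + (1 - real (Cle h l)) + real (Cle h l) * real (hermg q)"
    proof -
      have aux: "c * (S * N * (1 - B / (S * c)) - H * L * M + (1 / c - 1) + G) =
          c * S * N - N * B - M * (H * L * c) + (1 - c) + c * G"
        if "c > 0" "S > 0" for c S N B H L M G :: real
        using that by (simp add: field_simps)
      show ?thesis unfolding tau_max_def Wr by (rule aux) (use Cpos s in auto)
    qed
    moreover have "real (Cle h l) * tau_max q h mH s l < real (Cle h l) * real tau"
      using tau Cpos by simp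
    ultimately show ?thesis
      by (simp add: Cl_def Ci_def Wi_def t_def g_def n_def m_def algebra_simps)
  qed
  then have "Cl * (t + 1 - g) - n * Wi - (Cl - Ci) * int s * n + m * Wle > 1" by linarith
  with bound show ?thesis by linarith
qed

context hermitian_curve
begin

section \<open>A second solution\<close>

text \<open>G^s involves X only, so a remainder modulo G^s is taken separately in each
  Y-coefficient.\<close>

definition modG :: "nat \<Rightarrow> 'a poly poly \<Rightarrow> 'a poly poly" where
  "modG s w = map_poly (\<lambda>c. c mod gpoly ^ s) w"

text \<open>There are s q^2 powers of X and q powers of Y, so a congruence modulo G^s counts as s
  q^3 = s n equations.\<close>

definition residues :: "nat \<Rightarrow> 'a poly poly set" where
  "residues s = {f. \<forall>i j. coeff (coeff f j) i \<noteq> 0 \<longrightarrow> (i, j) \<in> {..<s * q ^ 2} \<times> {..<q}}"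

lemma card_residues: "card (residues s) = card (UNIV :: 'a set) ^ (s * q ^ 3)"
  unfolding residues_def
  by (subst card_supported) (simp_all add: card_cartesian_product power2_eq_square power3_eq_cube mult_ac)

lemma modG_in_residues:
  assumes "inR q w" "s > 0" shows "modG s w \<in> residues s"
  unfolding residues_def
proof (intro CollectI allI impI)
  fix i j assume "coeff (coeff (modG s w) j) i \<noteq> 0"
  then have nz: "coeff (coeff w j mod gpoly ^ s) i \<noteq> 0" by (simp add: modG_def coeff_map_poly)
  then have "coeff w j \<noteq> 0" by auto
  then have "j < q" using assms(1) le_degree[of w j] by (simp add: inR_def)
  have "degree (gpoly ^ s) = s * q ^ 2" by (simp add: degree_power_eq gpoly_nz degree_gpoly)
  moreover have "degree (coeff w j mod gpoly ^ s) < degree (gpoly ^ s)"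
    using nz by (intro degree_mod_less') (auto simp: gpoly_nz)
  moreover have "i \<le> degree (coeff w j mod gpoly ^ s)" by (rule le_degree[OF nz])
  ultimately show "(i, j) \<in> {..<s * q ^ 2} \<times> {..<q}" using \<open>j < q\<close> by auto
qed

lemma modG_eqD:
  assumes "modG s v = modG s w"
  shows "\<exists>t. v - w = t * hermG q ^ s"
proof -
  have "coeff v j mod gpoly ^ s = coeff w j mod gpoly ^ s" for j
    using arg_cong[OF assms, of "\<lambda>p. coeff p j"] by (simp add: modG_def coeff_map_poly)
  then have "gpoly ^ s dvd coeff (v - w) j" for j by (simp add: mod_eq_dvd_iff)
  then have "[:gpoly ^ s:] dvd v - w" by (simp add: const_poly_dvd_iff)
  then show ?thesis unfolding hermG_eq poly_const_pow by (metis dvdE mult.commute)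
qed

lemma degH_le_hermG: "degH_le q (hermG q :: 'a poly poly) (int (q ^ 3))"
  unfolding hermG_eq monom_0[symmetric]
proof (rule degH_le_monom)
  fix i assume "coeff gpoly i \<noteq> 0"
  then have "i \<le> q ^ 2" using le_degree[of gpoly i] by (simp add: degree_gpoly)
  then have "i * q \<le> q ^ 2 * q" by (rule mult_le_mono1)
  then show "int (i * q + 0 * (q + 1)) \<le> int (q ^ 3)"
    unfolding of_nat_le_iff by (simp add: power2_eq_square power3_eq_cube)
qed

text \<open>The allowance 2g - 1 per unit of |i| in \<open>x\<close> and the weight n of each G add
  up to the n + 2g - 1 of the factor R that G replaces, so the bound depends on j alone.\<close>

lemma degH_le_Aent:
  fixes x :: "'a poly poly"
  assumes R: "\<And>\<mu>. \<mu> < h \<Longrightarrow> degH_le q (R \<mu>) (int (q ^ 3 + 2 * hermg q) - 1)"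
    and x: "degH_le q x (int tau + int (absm h i) * (2 * int (hermg q) - 1))"
  shows "degH_le q (x * Aent q h R i j) (int tau + int (absm h j) * (int (q ^ 3 + 2 * hermg q) - 1))"
proof (cases "\<forall>\<mu><h. i \<mu> \<le> j \<mu>")
  case True
  let ?d = "int (q ^ 3 + 2 * hermg q) - 1"
  have "(\<Sum>\<mu><h. int (j \<mu> - i \<mu>) * ?d) = (int (absm h j) - int (absm h i)) * ?d"
    unfolding absm_def of_nat_sum sum_subtractf[symmetric] sum_distrib_right
    using True by (intro sum.cong) (auto simp: of_nat_diff)
  then have sum_eq: "(0 + (\<Sum>\<mu><h. int (j \<mu> - i \<mu>) * ?d)) = (int (absm h j) - int (absm h i)) * ?d"
    by simp
  have "degH_le q (x * (of_nat (\<Prod>\<mu><h. j \<mu> choose i \<mu>) * (\<Prod>\<mu><h. R \<mu> ^ (j \<mu> - i \<mu>)) * hermG q ^ absm h i))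
      ((int tau + int (absm h i) * (2 * int (hermg q) - 1)) +
       ((0 + (\<Sum>\<mu><h. int (j \<mu> - i \<mu>) * ?d)) + int (absm h i) * int (q ^ 3)))"
    by (intro degH_le_mult x degH_le_of_nat degH_le_prod degH_le_power degH_le_hermG R) simp_all
  moreover have "(int tau + int (absm h i) * (2 * int (hermg q) - 1)) +
      ((int (absm h j) - int (absm h i)) * ?d + int (absm h i) * int (q ^ 3)) = int tau + int (absm h j) * ?d"
    by (simp add: algebra_simps)
  ultimately show ?thesis unfolding sum_eq Aent_def if_P[OF True] by (simp only:)
next
  case False
  show ?thesis unfolding Aent_def if_not_P[OF False] by simp
qed

text \<open>The position (\<open>it\<close>, \<open>jt\<close>) is the monomial to be suppressed in
  \<open>lam\<close> at the zero index; it will be the leading monomial of the known solution.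
  Nonzero is meant for the whole family, so the direction may lie in the \<open>psi j\<close>
  alone.\<close>

lemma second_solution_direction:
  fixes R :: "nat \<Rightarrow> 'a poly poly"
  assumes h: "1 \<le> h" and mH: "mH < q ^ 3" and s: "0 < s" "s \<le> l"
    and tau: "real tau > tau_max q h mH s l"
    and R: "\<And>\<mu>. \<mu> < h \<Longrightarrow> degH_le q (R \<mu>) (int (q ^ 3 + 2 * hermg q) - 1)"
  obtains lam psi where
    "(\<exists>i\<in>Iset h s. lam i \<noteq> 0) \<or> (\<exists>j\<in>Jset h l. psi j \<noteq> 0)"
    "coeff (coeff (lam (\<lambda>_. 0)) jt) it = 0"
    "\<And>i. i \<in> Iset h s \<Longrightarrow> inR q (lam i) \<and>
      degH_le q (lam i) (int tau + int (absm h i) * (2 * int (hermg q) - 1))"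
    "\<And>j. j \<in> Jset h l \<Longrightarrow> inR q (psi j) \<and> degH_le q (psi j) (int tau + int (absm h j) * int mH)"
    "\<And>j. j \<in> Jset h l \<Longrightarrow> absm h j < s \<Longrightarrow>
      eqR q (psi j) (\<Sum>i\<in>Iset h s. lam i * Aent q h R i j)"
    "\<And>j. j \<in> Jset h l \<Longrightarrow> s \<le> absm h j \<Longrightarrow>
      congR q (psi j) (\<Sum>i\<in>Iset h s. lam i * Aent q h R i j) (hermG q ^ s)"
proof -
  have q: "q > 0" and q2: "q \<ge> 2" using q_ge_2 by auto
  have Q: "card (UNIV :: 'a set) > 1" using one_less_power[of q 2] q2 by (simp add: card_field)
  let ?a = "\<lambda>i. tau + absm h i * (2 * hermg q - 1)" and ?b = "\<lambda>j. tau + absm h j * mH"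
    and ?c = "\<lambda>j. tau + absm h j * (q ^ 3 + 2 * hermg q - 1)"
  have a: "int (?a i) = int tau + int (absm h i) * (2 * int (hermg q) - 1)" for i
    using hermg_ge_1 by (simp add: of_nat_diff)
  have c: "int (?c j) = int tau + int (absm h j) * (int (q ^ 3 + 2 * hermg q) - 1)" for j
    using hermg_ge_1 by (simp add: of_nat_diff)
  have bc: "?b j \<le> ?c j" for j using mH by (intro add_left_mono mult_le_mono2) linarith
  \<comment> \<open>Elements of \<open>PiE\<close> are fixed outside the index sets, so agreement on
    those sets is equality and the cardinalities multiply.\<close>
  define Dom where "Dom = PiE (Iset h s) (\<lambda>i. Lspace q (?a i) :: 'a poly poly set)
      \<times> PiE (Jset h l) (\<lambda>j. Lspace q (?b j) :: 'a poly poly set)"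
  define Cod where "Cod = PiE (Jset h l) (\<lambda>j. if absm h j < s then Lspace q (?c j) else residues s)
      \<times> (UNIV :: 'a set)"
  define S where "S lam j = (\<Sum>i\<in>Iset h s. lam i * Aent q h R i j)" for lam j
  \<comment> \<open>The defect of the key equation at j, to be zero for |j| < s and divisible by G^s
    otherwise.\<close>
  define w where "w z j = red q (S (fst z) j) - snd z j"
    for z :: "((nat \<Rightarrow> nat) \<Rightarrow> 'a poly poly) \<times> ((nat \<Rightarrow> nat) \<Rightarrow> 'a poly poly)" and j
  define \<Phi> where "\<Phi> z = (restrict (\<lambda>j. if absm h j < s then w z j else modG s (w z j)) (Jset h l),
      coeff (coeff (fst z (\<lambda>_. 0)) jt) it)" for z
  have cDom: "card Dom = card (UNIV :: 'a set) ^
      ((\<Sum>i\<in>Iset h s. ldim q (?a i)) + (\<Sum>j\<in>Jset h l. ldim q (?b j)))"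
    unfolding Dom_def using q by (simp add: card_cartesian_product card_PiE card_Lspace power_sum power_add)
  have cCod: "card Cod = card (UNIV :: 'a set) ^
      ((\<Sum>j\<in>Jset h l. if absm h j < s then ldim q (?c j) else s * q ^ 3) + 1)"
  proof -
    have "card (if absm h j < s then Lspace q (?c j) else residues s) =
        card (UNIV :: 'a set) ^ (if absm h j < s then ldim q (?c j) else s * q ^ 3)" for j
      using q by (simp add: card_Lspace card_residues)
    then show ?thesis
      unfolding Cod_def by (simp add: card_cartesian_product card_PiE power_sum power_add)
  qed
  have "card Cod < card Dom"
    unfolding cCod cDom using dimension_count[OF h mH s tau] Q by (rule power_strict_increasing)
  moreover have "\<Phi> ` Dom \<subseteq> Cod"
  proof
    fix y assume "y \<in> \<Phi> ` Dom"
    then obtain z where z: "z \<in> Dom" "y = \<Phi> z" by blast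
    have wj: "w z j \<in> Lspace q (?c j)" if "j \<in> Jset h l" for j
    proof -
      have zi: "degH_le q (fst z i) (int (?a i))" if "i \<in> Iset h s" for i
        using z(1) that by (auto simp: Dom_def Lspace_def)
      have "degH_le q (S (fst z) j) (int (?c j))"
        unfolding S_def c
      proof (rule degH_le_sum, rule degH_le_Aent[OF R])
        fix i assume "i \<in> Iset h s"
        from zi[OF this] show "degH_le q (fst z i) (int tau + int (absm h i) * (2 * int (hermg q) - 1))"
          unfolding a .
      qed
      then have "degH_le q (red q (S (fst z) j)) (int (?c j))" by (rule degH_le_red[OF q2])
      moreover have "snd z j \<in> Lspace q (?b j)" using z(1) that by (auto simp: Dom_def)
      then have psi_in: "inR q (snd z j)" and "degH_le q (snd z j) (int (?b j))"
        by (simp_all only: Lspace_def mem_Collect_eq)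
      have psi_le: "degH_le q (snd z j) (int (?c j))"
        by (rule degH_le_mono[OF \<open>degH_le q (snd z j) (int (?b j))\<close>], unfold of_nat_le_iff, rule bc)
      ultimately show ?thesis unfolding Lspace_def w_def using psi_in psi_le
        by (intro CollectI conjI inR_diff degH_le_diff inR_red q2)
    qed
    have "(if absm h j < s then w z j else modG s (w z j)) \<in>
        (if absm h j < s then Lspace q (?c j) else residues s)" if "j \<in> Jset h l" for j
      using wj[OF that] modG_in_residues s(1) by (simp add: Lspace_def)
    then have "restrict (\<lambda>j. if absm h j < s then w z j else modG s (w z j)) (Jset h l)
        \<in> PiE (Jset h l) (\<lambda>j. if absm h j < s then Lspace q (?c j) else residues s)"
      unfolding restrict_PiE_iff by (intro ballI)
    then show "y \<in> Cod" unfolding z(2) \<Phi>_def Cod_def by (intro SigmaI UNIV_I)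
  qed
  moreover have "card Cod > 0" unfolding cCod using Q by simp
  then have "finite Cod" by (rule card_ge_0_finite)
  ultimately have "card (\<Phi> ` Dom) < card Dom" by (meson card_mono le_less_trans)
  then have "\<not> inj_on \<Phi> Dom" by (rule pigeonhole)
  then obtain y z where yz: "y \<in> Dom" "z \<in> Dom" "y \<noteq> z" "\<Phi> y = \<Phi> z" unfolding inj_on_def by blast
  define lam where "lam i = fst y i - fst z i" for i
  define psi where "psi j = snd y j - snd z j" for j
  have Slam: "S lam j = S (fst y) j - S (fst z) j" for j
    unfolding S_def lam_def by (simp add: sum_subtractf algebra_simps)
  have wdiff: "w y j - w z j = red q (S lam j) - psi j" for j
    unfolding w_def Slam red_diff[OF q2] psi_def by simp
  have \<Phi>j: "(if absm h j < s then w y j else modG s (w y j)) = (if absm h j < s then w z j else modG s (w z j))"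
    if "j \<in> Jset h l" for j
  proof -
    have "fst (\<Phi> y) j = fst (\<Phi> z) j" using yz(4) by simp
    then show ?thesis using that by (simp add: \<Phi>_def)
  qed
  show thesis
  proof (rule that[of lam psi])
    show "(\<exists>i\<in>Iset h s. lam i \<noteq> 0) \<or> (\<exists>j\<in>Jset h l. psi j \<noteq> 0)"
    proof (rule ccontr)
      assume n: "\<not> ?thesis"
      have "fst y = fst z"
      proof (rule PiE_ext)
        show "fst y \<in> PiE (Iset h s) (\<lambda>i. Lspace q (?a i))" "fst z \<in> PiE (Iset h s) (\<lambda>i. Lspace q (?a i))"
          using yz(1,2) unfolding Dom_def by (simp_all only: mem_Times_iff)
        show "fst y i = fst z i" if "i \<in> Iset h s" for i using n that unfolding lam_def by auto
      qed
      moreover have "snd y = snd z"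
      proof (rule PiE_ext)
        show "snd y \<in> PiE (Jset h l) (\<lambda>j. Lspace q (?b j))" "snd z \<in> PiE (Jset h l) (\<lambda>j. Lspace q (?b j))"
          using yz(1,2) unfolding Dom_def by (simp_all only: mem_Times_iff)
        show "snd y j = snd z j" if "j \<in> Jset h l" for j using n that unfolding psi_def by auto
      qed
      ultimately show False using yz(3) by (simp add: prod_eq_iff)
    qed
    show "coeff (coeff (lam (\<lambda>_. 0)) jt) it = 0" using yz(4) by (simp add: lam_def \<Phi>_def)
    show "inR q (lam i) \<and> degH_le q (lam i) (int tau + int (absm h i) * (2 * int (hermg q) - 1))"
      if "i \<in> Iset h s" for i
    proof -
      have "fst y i \<in> Lspace q (?a i)" "fst z i \<in> Lspace q (?a i)"
        using yz(1,2) that by (auto simp: Dom_def)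
      then show ?thesis unfolding lam_def a[symmetric] Lspace_def by (auto intro: inR_diff degH_le_diff)
    qed
    show "inR q (psi j) \<and> degH_le q (psi j) (int tau + int (absm h j) * int mH)"
      if "j \<in> Jset h l" for j
    proof -
      have "snd y j \<in> Lspace q (?b j)" "snd z j \<in> Lspace q (?b j)"
        using yz(1,2) that by (auto simp: Dom_def)
      then show ?thesis unfolding psi_def Lspace_def by (auto intro: inR_diff degH_le_diff)
    qed
    show "eqR q (psi j) (\<Sum>i\<in>Iset h s. lam i * Aent q h R i j)" if "j \<in> Jset h l" "absm h j < s" for j
    proof -
      have "w y j = w z j" using \<Phi>j[OF that(1)] that(2) by simp
      then have "psi j = red q (S lam j)" using wdiff[of j] by simp
      then show ?thesis using eqR_sym[OF eqR_red[OF q2, of "S lam j"]] by (simp add: S_def)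
    qed
    show "congR q (psi j) (\<Sum>i\<in>Iset h s. lam i * Aent q h R i j) (hermG q ^ s)"
      if "j \<in> Jset h l" "s \<le> absm h j" for j
    proof -
      \<comment> \<open>Equal remainders make the difference of the two defects a multiple of G^s,
        which is the congruence for the difference family.\<close>
      have "modG s (w y j) = modG s (w z j)" using \<Phi>j[OF that(1)] that(2) by simp
      then obtain t where "w y j - w z j = t * hermG q ^ s" using modG_eqD by blast
      then have "red q (S lam j) = t * hermG q ^ s + psi j" unfolding wdiff by (simp only: diff_eq_eq)
      then have "psi j = red q (S lam j) + (- t) * hermG q ^ s" by simp
      then have "eqR q (psi j) (S lam j + (- t) * hermG q ^ s)"
        using eqR_add[OF eqR_sym[OF eqR_red[OF q2, of "S lam j"]] eqR_refl] by metis
      then show ?thesis unfolding congR_def S_def by blast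
    qed
  qed
qed

text \<open>Apart from monicity, the conditions at fixed degree are preserved by addition. As the
  perturbation has coefficient 0 at (\<open>it\<close>, \<open>jt\<close>) and does not exceed the
  degree of \<open>lam0\<close> at the zero index, the leading coefficient 1 and the degree
  survive.\<close>

lemma perturbed_solution:
  assumes sol: "is_solution q h mH s l R lam0 psi0"
    and top: "coeff (coeff (lam0 (\<lambda>_. 0)) jt) it = 1" "it * q + jt * (q + 1) = degH q (lam0 (\<lambda>_. 0))"
    and s: "0 < s"
    and d0: "coeff (coeff (lam (\<lambda>_. 0)) jt) it = 0"
    and lam: "\<And>i. i \<in> Iset h s \<Longrightarrow> inR q (lam i) \<and>
      degH_le q (lam i) (int (degH q (lam0 (\<lambda>_. 0))) + int (absm h i) * (2 * int (hermg q) - 1))"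
    and psi: "\<And>j. j \<in> Jset h l \<Longrightarrow> inR q (psi j) \<and>
      degH_le q (psi j) (int (degH q (lam0 (\<lambda>_. 0))) + int (absm h j) * int mH)"
    and eq1: "\<And>j. j \<in> Jset h l \<Longrightarrow> absm h j < s \<Longrightarrow>
      eqR q (psi j) (\<Sum>i\<in>Iset h s. lam i * Aent q h R i j)"
    and eq2: "\<And>j. j \<in> Jset h l \<Longrightarrow> s \<le> absm h j \<Longrightarrow>
      congR q (psi j) (\<Sum>i\<in>Iset h s. lam i * Aent q h R i j) (hermG q ^ s)"
  shows "is_solution q h mH s l R (\<lambda>i. lam0 i + lam i) (\<lambda>j. psi0 j + psi j)"
    and "degH q (lam0 (\<lambda>_. 0) + lam (\<lambda>_. 0)) = degH q (lam0 (\<lambda>_. 0))"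
proof -
  have zI: "(\<lambda>_. 0) \<in> Iset h s" using s by (simp add: Iset_def mi_def absm_def)
  have "degH_le q (lam (\<lambda>_. 0)) (int (degH q (lam0 (\<lambda>_. 0))))"
    using lam[OF zI] by (simp add: absm_def)
  then have "degH_le q (lam0 (\<lambda>_. 0) + lam (\<lambda>_. 0)) (int (degH q (lam0 (\<lambda>_. 0))))"
    by (intro degH_le_add degH_le_degH)
  from degH_eqI[OF this _ top(2)]
  show deg: "degH q (lam0 (\<lambda>_. 0) + lam (\<lambda>_. 0)) = degH q (lam0 (\<lambda>_. 0))"
    using top(1) d0 by simp
  have S: "(\<Sum>i\<in>Iset h s. (lam0 i + lam i) * Aent q h R i j) =
      (\<Sum>i\<in>Iset h s. lam0 i * Aent q h R i j) + (\<Sum>i\<in>Iset h s. lam i * Aent q h R i j)" for j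
    by (simp add: sum.distrib distrib_right)
  have monic: "monicH q (lam0 (\<lambda>_. 0) + lam (\<lambda>_. 0))"
    unfolding monicH_def deg
  proof (intro conjI exI)
    show co: "coeff (coeff (lam0 (\<lambda>_. 0) + lam (\<lambda>_. 0)) jt) it = 1" using top(1) d0 by simp
    then show "lam0 (\<lambda>_. 0) + lam (\<lambda>_. 0) \<noteq> 0" by (metis coeff_0 zero_neq_one)
    show "inR q (lam0 (\<lambda>_. 0) + lam (\<lambda>_. 0))"
      using sol lam zI by (intro inR_add) (auto simp: is_solution_def)
  qed (rule top(2))
  show "is_solution q h mH s l R (\<lambda>i. lam0 i + lam i) (\<lambda>j. psi0 j + psi j)"
    unfolding is_solution_def deg S
  proof (intro conjI ballI impI monic)
    note sol' = sol[unfolded is_solution_def]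
    show "inR q (lam0 i + lam i)" if "i \<in> Iset h s" for i using sol' lam that by (blast intro: inR_add)
    show "inR q (psi0 j + psi j)" if "j \<in> Jset h l" for j using sol' psi that by (blast intro: inR_add)
    show "eqR q (psi0 j + psi j)
      ((\<Sum>i\<in>Iset h s. lam0 i * Aent q h R i j) + (\<Sum>i\<in>Iset h s. lam i * Aent q h R i j))"
      if "j \<in> Jset h l" "absm h j < s" for j
      using sol' eq1[OF that] that by (blast intro: eqR_add)
    show "congR q (psi0 j + psi j)
      ((\<Sum>i\<in>Iset h s. lam0 i * Aent q h R i j) + (\<Sum>i\<in>Iset h s. lam i * Aent q h R i j)) (hermG q ^ s)"
      if "j \<in> Jset h l" "s \<le> absm h j" for j
    proof -
      let ?A = "\<Sum>i\<in>Iset h s. lam0 i * Aent q h R i j" and ?B = "\<Sum>i\<in>Iset h s. lam i * Aent q h R i j"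
      have "congR q (psi0 j) ?A (hermG q ^ s)" "congR q (psi j) ?B (hermG q ^ s)"
        using sol' that eq2 by blast+
      then obtain t u where "eqR q (psi0 j) (?A + t * hermG q ^ s)" "eqR q (psi j) (?B + u * hermG q ^ s)"
        unfolding congR_def by blast
      from eqR_add[OF this] have "eqR q (psi0 j + psi j) (?A + ?B + (t + u) * hermG q ^ s)"
        by (simp only: distrib_right add_ac)
      then show ?thesis unfolding congR_def by blast
    qed
    show "degH_le q (lam0 i + lam i)
        (int (degH q (lam0 (\<lambda>_. 0))) + int (absm h i) * (2 * int (hermg q) - 1))" if "i \<in> Iset h s" for i
      using sol' lam[OF that] that by (blast intro: degH_le_add)
    show "degH_le q (psi0 j + psi j) (int (degH q (lam0 (\<lambda>_. 0))) + int (absm h j) * int mH)"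
      if "j \<in> Jset h l" for j
      using sol' psi[OF that] that by (blast intro: degH_le_add)
  qed
qed

end

theorem theorem4:
  fixes q h mH s l tau :: nat
    and f :: "nat \<Rightarrow> 'a::{field,finite} poly poly"
    and e :: "nat \<Rightarrow> 'a \<times> 'a \<Rightarrow> 'a"
    and R :: "nat \<Rightarrow> 'a poly poly"
  assumes "\<exists>p k. prime p \<and> 0 < k \<and> q = p ^ k"
    and "card (UNIV :: 'a set) = q ^ 2"
    and "1 \<le> h"
    and "2 * (int (hermg q) - 1) < int mH" and "mH < q ^ 3"
    and "\<forall>i<h. inR q (f i) \<and> degH_le q (f i) (int mH)"
    and "\<forall>\<mu><h. inR q (R \<mu>) \<and> degH_le q (R \<mu>) (int (q ^ 3 + 2 * hermg q) - 1) \<and>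
            (\<forall>P\<in>hermPts q. evalH (R \<mu>) P = evalH (f \<mu>) P + e \<mu> P)"
    and "0 < s" and "s \<le> l"
    and "tau = tauH q h s e"
    and "tau + l * mH < s * q ^ 3"
    and "real tau > tau_max q h mH s l"
  shows "\<exists>lam1 psi1 lam2 psi2.
           is_solution q h mH s l R lam1 psi1 \<and> degH q (lam1 (\<lambda>_. 0)) = tau \<and>
           is_solution q h mH s l R lam2 psi2 \<and> degH q (lam2 (\<lambda>_. 0)) = tau \<and>
           ((\<exists>i\<in>Iset h s. lam1 i \<noteq> lam2 i) \<or> (\<exists>j\<in>Jset h l. psi1 j \<noteq> psi2 j))"
proof -
  interpret hermitian_curve q "TYPE('a)"
    using assms(1,2) by unfold_locales
  obtain L where L: "monicH q L" "degH q L = tau" "\<And>P. P \<in> errset q h e \<Longrightarrow> val_ge q L P s"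
    using ex_locator[of h s e] assms(10) by metis
  obtain lam0 psi0 where sol: "is_solution q h mH s l R lam0 psi0" and lam0: "lam0 (\<lambda>_. 0) = L"
    using transmitted_solution[OF assms(5,6,7,8) L(1,3)] by blast
  \<comment> \<open>The position of the leading monomial of the locator is the one at which the
    perturbation must have coefficient 0.\<close>
  obtain it jt where top: "coeff (coeff L jt) it = 1" "it * q + jt * (q + 1) = degH q L"
    using L(1) unfolding monicH_def by blast
  have R: "degH_le q (R \<mu>) (int (q ^ 3 + 2 * hermg q) - 1)" if "\<mu> < h" for \<mu>
    using assms(7) that by blast
  show ?thesis
  proof (rule second_solution_direction[OF assms(3,5,8,9,12) R, where jt = jt and it = it])
    fix lam psi
    assume ne: "(\<exists>i\<in>Iset h s. lam i \<noteq> 0) \<or> (\<exists>j\<in>Jset h l. psi j \<noteq> 0)"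
      and d: "coeff (coeff (lam (\<lambda>_. 0)) jt) it = 0"
        "\<And>i. i \<in> Iset h s \<Longrightarrow> inR q (lam i) \<and>
          degH_le q (lam i) (int tau + int (absm h i) * (2 * int (hermg q) - 1))"
        "\<And>j. j \<in> Jset h l \<Longrightarrow> inR q (psi j) \<and> degH_le q (psi j) (int tau + int (absm h j) * int mH)"
        "\<And>j. j \<in> Jset h l \<Longrightarrow> absm h j < s \<Longrightarrow>
          eqR q (psi j) (\<Sum>i\<in>Iset h s. lam i * Aent q h R i j)"
        "\<And>j. j \<in> Jset h l \<Longrightarrow> s \<le> absm h j \<Longrightarrow>
          congR q (psi j) (\<Sum>i\<in>Iset h s. lam i * Aent q h R i j) (hermG q ^ s)"
    have deg0: "degH q (lam0 (\<lambda>_. 0)) = tau" by (simp add: lam0 L(2))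
    note perturbed = perturbed_solution[where lam = lam and psi = psi, OF sol top[folded lam0] assms(8) d(1), unfolded deg0]
    have 1: "is_solution q h mH s l R (\<lambda>i. lam0 i + lam i) (\<lambda>j. psi0 j + psi j)"
      by (rule perturbed(1); rule d; assumption)
    have 2: "degH q (lam0 (\<lambda>_. 0) + lam (\<lambda>_. 0)) = tau"
      by (rule perturbed(2); rule d; assumption)
    show ?thesis
    proof (intro exI conjI)
      show "is_solution q h mH s l R lam0 psi0" by (rule sol)
      show "degH q (lam0 (\<lambda>_. 0)) = tau" by (rule deg0)
      show "is_solution q h mH s l R (\<lambda>i. lam0 i + lam i) (\<lambda>j. psi0 j + psi j)" by (rule 1)
      show "degH q (lam0 (\<lambda>_. 0) + lam (\<lambda>_. 0)) = tau" by (rule 2)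
      show "(\<exists>i\<in>Iset h s. lam0 i \<noteq> lam0 i + lam i) \<or> (\<exists>j\<in>Jset h l. psi0 j \<noteq> psi0 j + psi j)"
        using ne by simp
    qed
  qed
qed

end
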